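(* Let $r\ge 1$, and let $(c_j(t))_{t\in\mathbb Z}$, $1\le j\le r$, be arbitrary sequences of nonzero complex numbers and $b$ an arbitrary nonzero complex number (generic, so that no denominators below vanish). Define lower-triangular matrices $f=(f_{\mathbf n\mathbf k})_{\mathbf n,\mathbf k\in\mathbb Z^r}$ and $g=(g_{\mathbf k\mathbf l})_{\mathbf k,\mathbf l\in\mathbb Z^r}$ by $$f_{\mathbf n\mathbf k}=\prod_{i=1}^r\frac{\prod_{t=k_i}^{n_i-1}\Big\{\theta\big(c_i(t)b/c_1(k_1)\cdots c_r(k_r)\big)\prod_{j=1}^r\theta\big(c_i(t)c_j(k_j)\big)\Big\}}{\prod_{t=k_i+1}^{n_i}\Big\{\theta\big(c_i(t)c_1(k_1)\cdots c_r(k_r)/b\big)\prod_{j=1}^r\theta\big(c_i(t)/c_j(k_j)\big)\Big\}}\qquad(\mathbf n\ge\mathbf k)$$ and $$g_{\mathbf k\mathbf l}=\prod_{1\le i<j\le r}\frac{\theta\big(c_j(l_j)c_i(l_i)^\pm\big)}{\theta\big(c_j(k_j)c_i(k_i)^\pm\big)}\prod_{j=1}^r\frac{c_j(l_j)^{r+1-j}\,\theta\big(c_j(l_j)^2\big)}{c_j(k_j)^{r+1-j}\,\theta\big(c_j(k_j)^2\big)}$$ $$\times\prod_{i=1}^r\frac{\prod_{t=l_i+1}^{k_i}\Big\{\theta\big(c_i(t)b/c_1(k_1)\cdots c_r(k_r)\big)\prod_{j=1}^r\theta\big(c_i(t)c_j(k_j)\big)\Big\}}{\prod_{t=l_i}^{k_i-1}\Big\{\theta\big(c_i(t)c_1(k_1)\cdots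 c_r(k_r)/b\big)\prod_{j=1}^r\theta\big(c_i(t)/c_j(k_j)\big)\Big\}}\qquad(\mathbf k\ge\mathbf l),$$ all other entries being $0$; here $c_i(t)b/c_1(k_1)\cdots c_r(k_r)$ means $c_i(t)b$ divided by the product $c_1(k_1)\cdots c_r(k_r)$. Then $f$ and $g$ are mutually inverse.
   Context: Fix a complex number $p$ with $|p|<1$. For $x\in\mathbb C\setminus\{0\}$ put $\theta(x)=\theta(x;p)=\prod_{j=0}^\infty(1-p^jx)(1-p^{j+1}/x)$, and write $\theta(xy^\pm)=\theta(xy)\theta(x/y)$. For $\mathbf n,\mathbf k\in\mathbb Z^r$, $\mathbf n\ge\mathbf k$ means $n_i\ge k_i$ for all $i$. A matrix $(f_{\mathbf n\mathbf k})_{\mathbf n,\mathbf k\in\mathbb Z^r}$ is lower-triangular if $f_{\mathbf n\mathbf k}=0$ unless $\mathbf n\ge\mathbf k$. Lower-triangular matrices $f,g$ are mutually inverse if $\sum_{\mathbf l\le\mathbf k\le\mathbf n}f_{\mathbf n\mathbf k}g_{\mathbf k\mathbf l}=\delta_{\mathbf n\mathbf l}$ for all $\mathbf n,\mathbf l$ (equivalently $\sum_{\mathbf l\le\mathbf k\le\mathbf n}g_{\mathbf n\mathbf k}f_{\mathbf k\mathbf l}=\delta_{\mathbf n\mathbf l}$). Empty products are $1$. Parameters are assumed generic so that no denominator vanishes. *)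

theory Defs
  imports "HOL-Analysis.Analysis"
begin

definition theta :: "complex \<Rightarrow> complex \<Rightarrow> complex" where
  "theta p x = (\<Prod>j. (1 - p ^ j * x) * (1 - p ^ (j + 1) / x))"

text \<open>The value \<open>\<theta>(xy\<^sup>\<plusminus>)\<close>; the sign refers to the exponent of the last argument.\<close>

definition theta_pm :: "complex \<Rightarrow> complex \<Rightarrow> complex \<Rightarrow> complex" where
  "theta_pm p x y = theta p (x * y) * theta p (x / y)"

text \<open>An element of \<open>\<int>\<^sup>r\<close> is an extensional function on \<open>{1..r}\<close> (constantly \<open>undefined\<close> elsewhere),
  so that equality of such functions is equality of the \<open>r\<close> components.\<close>

definition multi_index :: "nat \<Rightarrow> (nat \<Rightarrow> int) set" where
  "multi_index r = ({1..r} \<rightarrow>\<^sub>E UNIV)"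

definition mi_le :: "nat \<Rightarrow> (nat \<Rightarrow> int) \<Rightarrow> (nat \<Rightarrow> int) \<Rightarrow> bool" where
  "mi_le r k n \<longleftrightarrow> (\<forall>i\<in>{1..r}. k i \<le> n i)"

type_synonym mi_matrix = "(nat \<Rightarrow> int) \<Rightarrow> (nat \<Rightarrow> int) \<Rightarrow> complex"

definition lower_triangular :: "nat \<Rightarrow> mi_matrix \<Rightarrow> bool" where
  "lower_triangular r f \<longleftrightarrow>
     (\<forall>n\<in>multi_index r. \<forall>k\<in>multi_index r. \<not> mi_le r k n \<longrightarrow> f n k = 0)"

definition mi_product :: "nat \<Rightarrow> mi_matrix \<Rightarrow> mi_matrix \<Rightarrow> mi_matrix" where
  "mi_product r f g n l =
     (\<Sum>k\<in>{k\<in>multi_index r. mi_le r l k \<and> mi_le r k n}. f n k * g k l)"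

text \<open>For lower-triangular matrices either of the two families of equations below implies the other;
  both are required, so that the relation is visibly symmetric.\<close>

definition mutually_inverse :: "nat \<Rightarrow> mi_matrix \<Rightarrow> mi_matrix \<Rightarrow> bool" where
  "mutually_inverse r f g \<longleftrightarrow>
     lower_triangular r f \<and> lower_triangular r g \<and>
     (\<forall>n\<in>multi_index r. \<forall>l\<in>multi_index r.
        mi_product r f g n l = (if n = l then 1 else 0) \<and>
        mi_product r g f n l = (if n = l then 1 else 0))"

definition cprod :: "nat \<Rightarrow> (nat \<Rightarrow> int \<Rightarrow> complex) \<Rightarrow> (nat \<Rightarrow> int) \<Rightarrow> complex" where
  "cprod r c k = (\<Prod>j\<in>{1..r}. c j (k j))"

definition num_factor ::
  "nat \<Rightarrow> complex \<Rightarrow> (nat \<Rightarrow> int \<Rightarrow> complex) \<Rightarrow> complex \<Rightarrow> (nat \<Rightarrow> int) \<Rightarrow> nat \<Rightarrow> int \<Rightarrow> complex" where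
  "num_factor r p c b k i t =
     theta p (c i t * b / cprod r c k) * (\<Prod>j\<in>{1..r}. theta p (c i t * c j (k j)))"

definition den_factor ::
  "nat \<Rightarrow> complex \<Rightarrow> (nat \<Rightarrow> int \<Rightarrow> complex) \<Rightarrow> complex \<Rightarrow> (nat \<Rightarrow> int) \<Rightarrow> nat \<Rightarrow> int \<Rightarrow> complex" where
  "den_factor r p c b k i t =
     theta p (c i t * cprod r c k / b) * (\<Prod>j\<in>{1..r}. theta p (c i t / c j (k j)))"

definition f_mat :: "nat \<Rightarrow> complex \<Rightarrow> (nat \<Rightarrow> int \<Rightarrow> complex) \<Rightarrow> complex \<Rightarrow> mi_matrix" where
  "f_mat r p c b n k =
     (if mi_le r k n then
        (\<Prod>i\<in>{1..r}. (\<Prod>t\<in>{k i..n i - 1}. num_factor r p c b k i t)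
                    / (\<Prod>t\<in>{k i + 1..n i}. den_factor r p c b k i t))
      else 0)"

definition g_mat :: "nat \<Rightarrow> complex \<Rightarrow> (nat \<Rightarrow> int \<Rightarrow> complex) \<Rightarrow> complex \<Rightarrow> mi_matrix" where
  "g_mat r p c b k l =
     (if mi_le r l k then
        (\<Prod>(i, j)\<in>{(i, j). 1 \<le> i \<and> i < j \<and> j \<le> r}.
            theta_pm p (c j (l j)) (c i (l i)) / theta_pm p (c j (k j)) (c i (k i)))
        * (\<Prod>j\<in>{1..r}. (c j (l j) ^ (r + 1 - j) * theta p ((c j (l j))\<^sup>2))
                      / (c j (k j) ^ (r + 1 - j) * theta p ((c j (k j))\<^sup>2)))
        * (\<Prod>i\<in>{1..r}. (\<Prod>t\<in>{l i + 1..k i}. num_factor r p c b k i t)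
                      / (\<Prod>t\<in>{l i..k i - 1}. den_factor r p c b k i t))
      else 0)"

text \<open>Non-vanishing of exactly the theta factors that occur in denominators of some entry. In the
  first clause the values \<open>t > k i\<close> come from \<open>f_mat\<close> and the values \<open>t < k i\<close> from
  \<open>g_mat\<close>; the other two clauses come from the prefactor of \<open>g_mat\<close>.\<close>

definition generic :: "nat \<Rightarrow> complex \<Rightarrow> (nat \<Rightarrow> int \<Rightarrow> complex) \<Rightarrow> complex \<Rightarrow> bool" where
  "generic r p c b \<longleftrightarrow>
     (\<forall>k\<in>multi_index r.
        (\<forall>i\<in>{1..r}. \<forall>t. t \<noteq> k i \<longrightarrow> den_factor r p c b k i t \<noteq> 0) \<and>
        (\<forall>i j. 1 \<le> i \<and> i < j \<and> j \<le> r \<longrightarrow> theta_pm p (c j (k j)) (c i (k i)) \<noteq> 0) \<and>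
        (\<forall>j\<in>{1..r}. theta p ((c j (k j))\<^sup>2) \<noteq> 0))"

end

theory Submission
  imports Defs
begin

text \<open>
  Fix \<open>l \<le> n\<close> with \<open>l \<noteq> n\<close> and write \<open>x\<^sub>i = c\<^sub>i(k\<^sub>i)\<close>. Up to a factor that does not depend on \<open>k\<close>, the product
  \<open>f\<^sub>n\<^sub>k g\<^sub>k\<^sub>l\<close> is a symmetric function of \<open>x\<^sub>1, \<dots>, x\<^sub>r\<close> times a Vandermonde product of type C, where
  \<open>x\<^sub>i\<close> runs over the points \<open>c\<^sub>i(t)\<close> with \<open>l\<^sub>i \<le> t \<le> n\<^sub>i\<close>. By antisymmetry, the sum does not change when
  one of the \<open>x\<^sub>i\<close> is allowed to run over the union of all these point sets, and the sum over this
  single variable vanishes by an elliptic partial fraction identity of type C. The latter holds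
  because \<open>\<theta>(xy) \<theta>(x/y) / x\<close> is a 2-by-2 determinant \<open>P(x) Q(y) - Q(x) P(y)\<close> by the Jacobi triple
  product identity, so that it reduces to Lagrange interpolation.
\<close>

section \<open>The theta function\<close>

text \<open>Two degenerate situations shape the details. If \<open>l i = n i\<close>, then
  \<open>f g\<close> has no numerator factor for the index i, whereas the uniform formula extracts
  one at x_i; the correction is a denominator at the only point of that grid, and it cancels just
  because that variable is frozen there. So the released variable must satisfy
  \<open>l i < n i\<close>, and such an index exists because l and n differ. Moreover, releasing a
  variable produces tuples outside the product of the grids, even with equal entries, where theta
  factors appear in denominators that no matrix entry contains. What makes the one-variable sum
  vanish is a count: in the released variable the numerator has exactly two antisymmetric factors
  fewer than there are points. Only \<open>f g\<close> is computed. The other product follows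
  formally from the unit diagonal of f and the finiteness of intervals of multi-indices.\<close>

definition q_poch :: "complex \<Rightarrow> complex \<Rightarrow> complex" where
  "q_poch p y = (\<Prod>j. 1 - p ^ (j + 1) * y)"

lemma summable_q_poch:
  fixes p y :: complex
  assumes "norm p < 1"
  shows "summable (\<lambda>j. norm (- (p ^ (j + 1) * y)))"
proof -
  have "summable (\<lambda>j. norm p ^ j * (norm p * norm y))"
    by (intro summable_mult2 summable_geometric) (use assms in auto)
  thus ?thesis by (simp add: norm_mult norm_power mult_ac)
qed

lemma convergent_prod_q_poch:
  fixes p y :: complex
  assumes "norm p < 1"
  shows "convergent_prod (\<lambda>j. 1 - p ^ (j + 1) * y)"
proof -
  have "convergent_prod (\<lambda>j. 1 + (- (p ^ (j + 1) * y)))"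
    by (intro abs_convergent_prod_imp_convergent_prod summable_imp_abs_convergent_prod)
       (use summable_q_poch[OF assms, of y] in auto)
  thus ?thesis by simp
qed

lemma q_poch_eq_0_iff:
  assumes "norm p < 1"
  shows "q_poch p y = 0 \<longleftrightarrow> (\<exists>j. p ^ (j + 1) * y = 1)"
proof -
  have "(\<lambda>j. 1 - p ^ (j + 1) * y) has_prod q_poch p y"
    unfolding q_poch_def by (rule convergent_prod_has_prod[OF convergent_prod_q_poch[OF assms]])
  from has_prod_eq_0_iff[OF this] show ?thesis by auto
qed

lemma q_poch_LIMSEQ:
  assumes "norm p < 1"
  shows "(\<lambda>N. \<Prod>j<N. 1 - p ^ (j + 1) * y) \<longlonglongrightarrow> q_poch p y"
  unfolding q_poch_def
  by (rule has_prod_imp_tendsto', rule convergent_prod_has_prod, rule convergent_prod_q_poch[OF assms])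

text \<open>The partial products converge uniformly on closed balls by comparison with a geometric
  series. Continuity is what later fills in the exceptional values of b.\<close>

lemma continuous_on_q_poch:
  assumes "norm p < 1"
  shows "continuous_on UNIV (q_poch p)"
proof -
  have "continuous_on (cball 0 r) (q_poch p)" for r :: real
  proof (rule uniform_limit_theorem)
    have "uniformly_convergent_on (cball 0 r) (\<lambda>N y. \<Prod>j<N. 1 + (- (p ^ (j + 1) * y)))"
    proof (rule uniformly_convergent_on_prod)
      show "uniformly_convergent_on (cball 0 r) (\<lambda>N y. \<Sum>n<N. norm (- (p ^ (n + 1) * y)))"
      proof (rule Weierstrass_m_test'_ev)
        show "\<forall>\<^sub>F n in sequentially. \<forall>x\<in>cball 0 r. norm (norm (- (p ^ (n + 1) * x))) \<le> norm p ^ n * (norm p * r)"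
          by (intro always_eventually allI ballI)
             (auto simp: norm_mult norm_power mult_ac intro!: mult_right_mono)
        show "summable (\<lambda>n. norm p ^ n * (norm p * r))"
          by (intro summable_mult2 summable_geometric) (use assms in auto)
      qed
    qed (auto intro!: continuous_intros)
    then obtain S where S: "uniform_limit (cball 0 r) (\<lambda>N y. \<Prod>j<N. 1 - p ^ (j + 1) * y) S sequentially"
      by (auto simp: uniformly_convergent_on_def)
    have "S y = q_poch p y" if "y \<in> cball 0 r" for y
      using tendsto_uniform_limitI[OF S that] q_poch_LIMSEQ[OF assms] LIMSEQ_unique by blast
    thus "uniform_limit (cball 0 r) (\<lambda>N y. \<Prod>j<N. 1 - p ^ (j + 1) * y) (q_poch p) sequentially"
      using S by (subst (asm) uniform_limit_cong[where i = "q_poch p"]) auto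
  qed (auto intro!: always_eventually continuous_intros)
  hence "continuous_on (ball 0 r) (q_poch p)" for r :: real
    using ball_subset_cball continuous_on_subset by blast
  hence "isCont (q_poch p) y" for y
    using continuous_on_interior[of "ball 0 (norm y + 1)" "q_poch p" y] by simp
  thus ?thesis by (simp add: continuous_on_eq_continuous_at)
qed

text \<open>With the unpaired factor 1 - x split off, the same function is evaluated at x and at
  1/x. Inversion of x therefore affects only that factor.\<close>

lemma theta_conv_q_poch:
  assumes "norm p < 1"
  shows "theta p x = (1 - x) * q_poch p x * q_poch p (1 / x)"
proof -
  have c: "convergent_prod (\<lambda>j. 1 - p ^ j * x)"
    using convergent_prod_q_poch[OF assms, of x]
    by (subst convergent_prod_iff_shift[of _ 1, symmetric]) simp
  have "(\<Prod>j. 1 - p ^ j * x) = (1 - x) * q_poch p x"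
  proof -
    have "(\<lambda>j. 1 - p ^ (j + 1) * x) has_prod q_poch p x"
      unfolding q_poch_def by (rule convergent_prod_has_prod[OF convergent_prod_q_poch[OF assms]])
    hence "(\<lambda>j. 1 - p ^ j * x) has_prod (q_poch p x * (1 - p ^ 0 * x))"
      by (intro has_prod_Suc_imp) simp
    thus ?thesis by (simp add: has_prod_unique[symmetric] mult_ac)
  qed
  moreover have "(\<Prod>j. 1 - p ^ j * x) * (\<Prod>j. 1 - p ^ (j + 1) * (1 / x)) = theta p x"
    unfolding theta_def by (subst prodinf_mult[OF c convergent_prod_q_poch[OF assms]]) simp
  ultimately show ?thesis by (simp add: q_poch_def)
qed

lemma theta_one [simp]: "norm p < 1 \<Longrightarrow> theta p 1 = 0"
  by (simp add: theta_conv_q_poch)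

lemma theta_inverse:
  assumes "norm p < 1" "x \<noteq> 0"
  shows "theta p (1 / x) = - theta p x / x"
  using assms by (simp add: theta_conv_q_poch field_simps)

lemma continuous_on_theta:
  assumes "norm p < 1" "continuous_on A g" "\<And>x. x \<in> A \<Longrightarrow> g x \<noteq> 0"
  shows "continuous_on A (\<lambda>x. theta p (g x))"
  unfolding theta_conv_q_poch[OF assms(1)]
  by (intro continuous_intros continuous_on_compose2[OF continuous_on_q_poch[OF assms(1)]])
     (use assms in auto)

lemma isCont_theta [continuous_intros]:
  assumes "norm p < 1" "isCont g x" "g x \<noteq> 0"
  shows "isCont (\<lambda>x. theta p (g x)) x"
proof -
  have "continuous_on (- {0}) (theta p)"
    by (rule continuous_on_theta) (use assms in auto)
  hence "isCont (theta p) (g x)"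
    using assms continuous_on_interior[of "- {0}" "theta p" "g x"]
    by (metis ComplI interior_open open_Compl closed_singleton singletonD)
  thus ?thesis using assms(2) isCont_o2 by blast
qed

text \<open>The zeros lie among 1, the powers of p and their inverses. Countability is used to bound
  the set of exceptional b.\<close>

lemma countable_theta_zeros:
  assumes "norm p < 1"
  shows "countable {z. theta p z = 0}"
proof -
  have "{z. theta p z = 0} \<subseteq> insert 1 (range (\<lambda>j. inverse (p ^ (j + 1))) \<union> range (\<lambda>j. p ^ (j + 1)))"
  proof
    fix z assume "z \<in> {z. theta p z = 0}"
    hence "z = 1 \<or> (\<exists>j. p ^ (j + 1) * z = 1) \<or> (\<exists>j. p ^ (j + 1) * (1 / z) = 1)"
      using assms by (simp add: theta_conv_q_poch q_poch_eq_0_iff)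
    moreover have "z = inverse w" if "w * z = 1" for w :: complex
      using inverse_unique[OF that] by simp
    moreover have "z = w" if "w * (1 / z) = 1" for w :: complex
      using that by (cases "z = 0") auto
    ultimately show "z \<in> insert 1 (range (\<lambda>j. inverse (p ^ (j + 1))) \<union> range (\<lambda>j. p ^ (j + 1)))"
      by blast
  qed
  thus ?thesis by (rule countable_subset) auto
qed

text \<open>Dividing by x makes the product antisymmetric. It is an elliptic analogue of a
  difference: at p = 0 it equals (x + 1/x) - (y + 1/y).\<close>

definition skew_theta :: "complex \<Rightarrow> complex \<Rightarrow> complex \<Rightarrow> complex" where
  "skew_theta p x y = theta p (x * y) * theta p (x / y) / x"

lemma skew_theta_commute:
  assumes "norm p < 1" "x \<noteq> 0" "y \<noteq> 0"
  shows "skew_theta p y x = - skew_theta p x y"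
proof -
  have "theta p (y / x) = - (y / x) * theta p (x / y)"
    using theta_inverse[OF assms(1), of "x / y"] assms(2,3) by simp
  thus ?thesis using assms(2,3) by (simp add: skew_theta_def mult.commute)
qed

section \<open>The Jacobi triple product identity\<close>

definition q_fact :: "complex \<Rightarrow> nat \<Rightarrow> complex" where
  "q_fact p n = (\<Prod>j<n. 1 - p ^ (j + 1))"

text \<open>The Gaussian binomial coefficient. The value 0 for k > m lets sums and the Pascal rule
  extend past the top index.\<close>

definition q_binom :: "complex \<Rightarrow> nat \<Rightarrow> nat \<Rightarrow> complex" where
  "q_binom p m k = (if k \<le> m then q_fact p m / (q_fact p k * q_fact p (m - k)) else 0)"

lemma q_fact_nonzero:
  assumes "norm p < 1"
  shows "q_fact p n \<noteq> 0"
proof -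
  have "p ^ (j + 1) \<noteq> 1" for j
  proof
    assume "p ^ (j + 1) = 1"
    hence "norm p ^ Suc j = 1" by (metis norm_one norm_power Suc_eq_plus1)
    moreover have "norm p ^ Suc j < 1"
      using assms by (cases "p = 0") (auto intro!: power_Suc_less_one simp del: power_Suc)
    ultimately show False by simp
  qed
  thus ?thesis by (simp add: q_fact_def)
qed

lemma q_fact_0 [simp]: "q_fact p 0 = 1"
  and q_fact_Suc: "q_fact p (Suc n) = q_fact p n * (1 - p * p ^ n)"
  by (simp_all add: q_fact_def)

lemma q_binom_0_right [simp]: "norm p < 1 \<Longrightarrow> q_binom p m 0 = 1"
  using q_fact_nonzero[of p m] by (simp add: q_binom_def)

lemma q_binom_Suc_Suc:
  assumes "norm p < 1" "k \<le> m"
  shows "q_binom p (Suc m) (Suc k) = q_binom p m (Suc k) + p ^ (m - k) * q_binom p m k"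
proof (cases "k = m")
  case True
  thus ?thesis using q_fact_nonzero[OF assms(1)] by (simp add: q_binom_def True)
next
  case False
  with assms obtain d where d: "m = Suc (k + d)"
    by (metis add_Suc_right le_neq_implies_less less_natE)
  have nz: "q_fact p n \<noteq> 0" "1 - p * p ^ n \<noteq> 0" for n
    using q_fact_nonzero[OF assms(1), of "Suc n"] by (auto simp: q_fact_Suc)
  show ?thesis
    using nz[of d] nz[of k] nz(1)[of "k + d"]
    by (simp add: q_binom_def d q_fact_Suc Suc_diff_le power_add) (simp add: divide_simps, simp add: algebra_simps)
qed

lemma q_binomial_theorem:
  assumes "norm p < 1"
  shows "(\<Prod>j<m. 1 - p ^ j * y) = (\<Sum>k\<le>m. (-1) ^ k * p ^ (k * (k - 1) div 2) * q_binom p m k * y ^ k)"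
proof (induction m)
  case 0
  thus ?case using assms by simp
next
  case (Suc m)
  define c where "c m k = (-1) ^ k * p ^ (k * (k - 1) div 2) * q_binom p m k" for m k
  have tri: "Suc k * (Suc k - 1) div 2 = k * (k - 1) div 2 + k" for k :: nat
    by (cases k) auto
  have rec: "c (Suc m) (Suc k) = c m (Suc k) - p ^ m * c m k" if "k \<le> m" for k
  proof -
    have "p ^ m = p ^ (m - k) * p ^ k" using that by (simp flip: power_add)
    thus ?thesis
      unfolding c_def tri q_binom_Suc_Suc[OF assms that] by (simp add: power_add algebra_simps)
  qed
  have "(\<Prod>j<Suc m. 1 - p ^ j * y) = (\<Sum>k\<le>m. c m k * y ^ k) - (\<Sum>k\<le>m. p ^ m * c m k * y ^ Suc k)"
  proof -
    have "(\<Prod>j<Suc m. 1 - p ^ j * y) = (\<Sum>k\<le>m. c m k * y ^ k) * (1 - p ^ m * y)"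
      by (simp add: Suc.IH c_def)
    also have "\<dots> = (\<Sum>k\<le>m. c m k * y ^ k) - (\<Sum>k\<le>m. c m k * y ^ k) * (p ^ m * y)"
      by (simp add: right_diff_distrib)
    finally show ?thesis by (simp add: sum_distrib_left sum_distrib_right mult_ac)
  qed
  also have "(\<Sum>k\<le>m. c m k * y ^ k) = (\<Sum>k\<le>Suc m. c m k * y ^ k)"
    by (simp add: c_def q_binom_def)
  also have "\<dots> = c m 0 + (\<Sum>k\<le>m. c m (Suc k) * y ^ Suc k)"
    by (subst sum.atMost_Suc_shift) simp
  also have "\<dots> - (\<Sum>k\<le>m. p ^ m * c m k * y ^ Suc k) = c m 0 + (\<Sum>k\<le>m. c (Suc m) (Suc k) * y ^ Suc k)"
    by (simp add: rec algebra_simps sum_subtractf)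
  also have "c m 0 = c (Suc m) 0"
    using assms by (simp add: c_def)
  also have "c (Suc m) 0 + (\<Sum>k\<le>m. c (Suc m) (Suc k) * y ^ Suc k) = (\<Sum>k\<le>Suc m. c (Suc m) k * y ^ k)"
    by (subst sum.atMost_Suc_shift) simp
  finally show ?case by (simp add: c_def)
qed

definition jacobi_term :: "complex \<Rightarrow> complex \<Rightarrow> int \<Rightarrow> complex" where
  "jacobi_term p x m = (-1) powi m * p powi (m * (m - 1) div 2) * x powi m"

text \<open>Apply the q-binomial theorem to 2N factors at y = x/p^N. The upper half of the factors
  is the product in x. The lower half, in reversed order, consists of 1 - x/p^(j+1), which is
  -x/p^(j+1) times the wanted factor 1 - p^(j+1)/x.\<close>

lemma finite_jacobi_triple_product:
  assumes "norm p < 1" "p \<noteq> 0" "x \<noteq> 0"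
  shows "(\<Prod>j<N. (1 - p ^ j * x) * (1 - p ^ (j + 1) / x)) =
           (\<Sum>m\<in>{- int N..int N}. q_binom p (2 * N) (nat (int N + m)) * jacobi_term p x m)"
proof -
  define y where "y = x / p ^ N"
  \<comment> \<open>\<open>K\<close> is the inverse of the product of all extracted factors
    -x/p^(j+1).\<close>
  define K where "K = (- x) powi (- int N) * p powi (int N * (int N + 1) div 2)"
  \<comment> \<open>The powers of p coming from \<open>K\<close>, from the q-binomial theorem and
    from y^k combine to the triangular exponent of the shifted index k - N.\<close>
  have tri: "int N * (int N + 1) div 2 + int (k * (k - 1) div 2) - int N * int k =
             (int k - int N) * (int k - int N - 1) div 2" for k
  proof -
    have "even (int N * (int N + 1))" "even (int k * (int k - 1))" by auto
    then obtain a b where e: "int N * (int N + 1) = 2 * a" "int k * (int k - 1) = 2 * b"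
      by (elim dvdE)
    have "int (k * (k - 1) div 2) = int k * (int k - 1) div 2"
      by (cases k) (auto simp: zdiv_int algebra_simps)
    moreover have "(int k - int N) * (int k - int N - 1) =
       int N * (int N + 1) + int k * (int k - 1) - 2 * (int N * int k)"
      by (simp add: algebra_simps)
    ultimately show ?thesis using e by simp
  qed
  have "(\<Prod>j<N. 1 - p ^ (j + 1) / x) = K * (\<Prod>j<N. 1 - p ^ j * y)"
  proof -
    have "(\<Prod>j<N. 1 - p ^ j * y) = (\<Prod>j<N. 1 - p ^ (N - Suc j) * y)"
      by (rule prod.nat_diff_reindex[symmetric])
    also have "\<dots> = (\<Prod>j<N. (- x / p ^ (j + 1)) * (1 - p ^ (j + 1) / x))"
    proof (rule prod.cong[OF refl])
      fix j assume "j \<in> {..<N}"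
      hence "p ^ N = p ^ (N - Suc j) * p ^ (j + 1)" by (simp flip: power_add del: power_Suc)
      thus "1 - p ^ (N - Suc j) * y = - x / p ^ (j + 1) * (1 - p ^ (j + 1) / x)"
        using assms by (simp add: y_def field_simps)
    qed
    also have "\<dots> = (\<Prod>j<N. - x / p ^ (j + 1)) * (\<Prod>j<N. 1 - p ^ (j + 1) / x)"
      by (rule prod.distrib)
    also have "K * \<dots> = (K * (\<Prod>j<N. - x / p ^ (j + 1))) * (\<Prod>j<N. 1 - p ^ (j + 1) / x)"
      by (simp add: mult.assoc)
    also have "K * (\<Prod>j<N. - x / p ^ (j + 1)) = 1"
    proof -
      define L where "L n = (- x) powi (- int n) * p powi (int n * (int n + 1) div 2)" for n
      have "L n * (\<Prod>j<n. - x / p ^ (j + 1)) = 1" for n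
      proof (induction n)
        case (Suc n)
        have "int (Suc n) * (int (Suc n) + 1) = int n * (int n + 1) + 2 * (int n + 1)"
          by (simp add: algebra_simps)
        hence t: "int (Suc n) * (int (Suc n) + 1) div 2 = int n * (int n + 1) div 2 + int (n + 1)"
          by simp
        have "- int (Suc n) = - int n - 1" by simp
        hence "(- x) powi (- int (Suc n)) = (- x) powi (- int n) / (- x)"
          using assms power_int_diff[of "- x" "- int n" 1] by (simp only: power_int_1_right) simp
        hence L: "L (Suc n) = L n * (p ^ (n + 1) / (- x))"
          unfolding t L_def using assms by (simp add: power_int_add)
        have "L (Suc n) * (\<Prod>j<Suc n. - x / p ^ (j + 1)) =
            (L n * (\<Prod>j<n. - x / p ^ (j + 1))) * (p ^ (n + 1) / (- x) * (- x / p ^ (n + 1)))"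
          unfolding L prod.lessThan_Suc by (simp only: mult_ac)
        thus ?case unfolding Suc.IH using assms by simp
      qed (simp add: L_def)
      thus ?thesis by (simp add: K_def L_def)
    qed
    finally show ?thesis by simp
  qed
  hence "(\<Prod>j<N. (1 - p ^ j * x) * (1 - p ^ (j + 1) / x)) =
           K * ((\<Prod>j<N. 1 - p ^ j * y) * (\<Prod>j<N. 1 - p ^ j * x))"
    by (simp add: prod.distrib mult_ac)
  also have "(\<Prod>j<N. 1 - p ^ j * x) = (\<Prod>j\<in>{N..<2 * N}. 1 - p ^ j * y)"
  proof -
    have "(\<Prod>j\<in>{N..<2 * N}. 1 - p ^ j * y) = (\<Prod>j\<in>{0 + N..<N + N}. 1 - p ^ j * y)"
      by (simp add: mult_2)
    also have "\<dots> = (\<Prod>j<N. 1 - p ^ (j + N) * y)"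
      by (subst prod.shift_bounds_nat_ivl) (simp add: lessThan_atLeast0)
    also have "\<dots> = (\<Prod>j<N. 1 - p ^ j * x)"
      using assms by (simp add: y_def power_add)
    finally show ?thesis ..
  qed
  also have "(\<Prod>j<N. 1 - p ^ j * y) * (\<Prod>j\<in>{N..<2 * N}. 1 - p ^ j * y) = (\<Prod>j<2*N. 1 - p ^ j * y)"
    unfolding lessThan_atLeast0 by (rule prod.atLeastLessThan_concat) auto
  also have "K * \<dots> = (\<Sum>k\<le>2*N. q_binom p (2 * N) k * jacobi_term p x (int k - int N))"
    unfolding q_binomial_theorem[OF assms(1)] sum_distrib_left
  proof (rule sum.cong[OF refl])
    fix k assume "k \<in> {..2 * N}"
    have "jacobi_term p x (int k - int N) =
        ((-1) powi int k / (-1) powi (int N)) * (p powi (int N * (int N + 1) div 2) * p ^ (k * (k - 1) div 2)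
        / (p ^ N) ^ k) * (x ^ k / x ^ N)"
      unfolding jacobi_term_def tri[symmetric] using assms
      by (simp add: power_int_diff power_int_add power_int_mult power_mult)
    thus "K * ((-1) ^ k * p ^ (k * (k - 1) div 2) * q_binom p (2 * N) k * y ^ k) =
            q_binom p (2 * N) k * jacobi_term p x (int k - int N)"
      using assms by (simp add: K_def y_def power_int_minus power_divide power_minus[of x N] field_simps)
  qed
  also have "\<dots> = (\<Sum>m\<in>{- int N..int N}. q_binom p (2 * N) (nat (int N + m)) * jacobi_term p x m)"
    by (rule sum.reindex_bij_witness[of _ "\<lambda>m. nat (int N + m)" "\<lambda>k. int k - int N"]) auto
  finally show ?thesis .
qed


section \<open>Absolute convergence of the bilateral series and the passage to the limit\<close>

lemma summable_on_int:
  fixes f :: "int \<Rightarrow> complex"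
  assumes "summable (\<lambda>n. norm (f (int n)))" "summable (\<lambda>n. norm (f (- int n)))"
  shows "(\<lambda>m. norm (f m)) summable_on UNIV"
proof -
  have "(\<lambda>m. norm (f m)) summable_on {0..}"
  proof (subst summable_on_reindex_bij_witness[where T = UNIV and i = int and j = nat and h = "\<lambda>n. norm (f (int n))"])
    show "(\<lambda>n. norm (f (int n))) summable_on UNIV"
      using assms(1) by (subst summable_on_UNIV_nonneg_real_iff) auto
  qed auto
  moreover have "(\<lambda>m. norm (f m)) summable_on {..0}"
  proof (subst summable_on_reindex_bij_witness[where T = UNIV and i = "\<lambda>n. - int n" and j = "\<lambda>m. nat (- m)"
        and h = "\<lambda>n. norm (f (- int n))"])
    show "(\<lambda>n. norm (f (- int n))) summable_on UNIV"
      using assms(2) by (subst summable_on_UNIV_nonneg_real_iff) auto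
  qed auto
  ultimately have "(\<lambda>m. norm (f m)) summable_on ({0..} \<union> ({..0} - {0..}))"
    by (intro summable_on_Un_disjoint) (auto intro: summable_on_subset_banach)
  moreover have "{0..} \<union> ({..0} - {0..}) = (UNIV :: int set)" by auto
  ultimately show ?thesis by simp
qed

text \<open>The ratio of consecutive terms is q^n y, which tends to 0.\<close>

lemma summable_power_triangular:
  fixes q y :: real
  assumes "0 \<le> q" "q < 1" "0 \<le> y"
  shows "summable (\<lambda>n. q ^ (n * (n - 1) div 2) * y ^ n)"
proof -
  have "(\<lambda>n. q ^ n * y) \<longlonglongrightarrow> 0 * y"
    by (intro tendsto_intros LIMSEQ_realpow_zero) (use assms in auto)
  hence "eventually (\<lambda>n. q ^ n * y < 1 / 2) sequentially"
    by (intro order_tendstoD) auto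
  then obtain N where N: "\<And>n. n \<ge> N \<Longrightarrow> q ^ n * y < 1 / 2"
    by (auto simp: eventually_at_top_linorder)
  show ?thesis
  proof (rule summable_ratio_test)
    fix n assume n: "n \<ge> N"
    have t: "Suc n * (Suc n - 1) div 2 = n * (n - 1) div 2 + n"
      by (cases n) auto
    have "norm (q ^ (Suc n * (Suc n - 1) div 2) * y ^ Suc n) =
          (q ^ n * y) * (q ^ (n * (n - 1) div 2) * y ^ n)"
      unfolding t using assms by (simp add: power_add abs_mult)
    also have "\<dots> \<le> 1 / 2 * (q ^ (n * (n - 1) div 2) * y ^ n)"
      by (intro mult_right_mono less_imp_le[OF N[OF n]]) (use assms in auto)
    finally show "norm (q ^ (Suc n * (Suc n - 1) div 2) * y ^ Suc n) \<le>
        1 / 2 * norm (q ^ (n * (n - 1) div 2) * y ^ n)"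
      using assms by simp
  qed simp
qed

lemma abs_summable_jacobi_term:
  assumes "norm p < 1" "p \<noteq> 0" "x \<noteq> 0"
  shows "(\<lambda>m. norm (jacobi_term p x m)) summable_on UNIV"
proof (rule summable_on_int)
  have tri: "int n * (int n - 1) div 2 = int (n * (n - 1) div 2)" for n
    by (cases n) (auto simp: zdiv_int algebra_simps)
  have n1: "norm (jacobi_term p x (int n)) = norm p ^ (n * (n - 1) div 2) * norm x ^ n" for n
    unfolding jacobi_term_def tri by (simp add: norm_mult norm_power norm_power_int)
  show "summable (\<lambda>n. norm (jacobi_term p x (int n)))"
    unfolding n1 by (rule summable_power_triangular) (use assms in auto)
  \<comment> \<open>Replacing m by -n gives a series of the same shape, with |p|/|x| in place of
    |x|.\<close>
  have "(- int n) * (- int n - 1) div 2 = int (n * (n - 1) div 2) + int n" for n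
  proof -
    have "(- int n) * (- int n - 1) = int n * (int n - 1) + 2 * int n"
      by (simp add: algebra_simps)
    hence "(- int n) * (- int n - 1) div 2 = int n * (int n - 1) div 2 + int n"
      by simp
    thus ?thesis by (simp add: tri)
  qed
  note tri' = this
  have n2: "norm (jacobi_term p x (- int n)) =
      norm p ^ (n * (n - 1) div 2) * (norm p / norm x) ^ n" for n
    unfolding jacobi_term_def tri' using assms
    by (simp add: norm_mult norm_power norm_power_int norm_inverse power_int_add power_int_minus
        divide_inverse power_mult_distrib power_inverse del: mult_minus_left)
  show "summable (\<lambda>n. norm (jacobi_term p x (- int n)))"
    unfolding n2 by (rule summable_power_triangular) (use assms in auto)
qed

lemma q_fact_LIMSEQ:
  assumes "norm p < 1"
  shows "q_fact p \<longlonglongrightarrow> q_poch p 1"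
  using q_poch_LIMSEQ[OF assms, of 1] by (simp add: q_fact_def[abs_def])

lemma q_poch_one_nonzero:
  assumes "norm p < 1"
  shows "q_poch p 1 \<noteq> 0"
proof
  assume "q_poch p 1 = 0"
  then obtain j where "p ^ (j + 1) = 1"
    using q_poch_eq_0_iff[OF assms] by auto
  hence "q_fact p (Suc j) = 0" by (simp add: q_fact_Suc)
  thus False using q_fact_nonzero[OF assms] by blast
qed

text \<open>The sequence \<open>q_fact p\<close> converges to a nonzero limit, so it and its inverse
  are bounded. The uniform constant supplies the dominating series in the triple product
  identity.\<close>

lemma q_binom_bounded:
  assumes "norm p < 1"
  obtains C where "\<And>m k. norm (q_binom p m k) \<le> C"
proof -
  have "Bseq (q_fact p)"
    using q_fact_LIMSEQ[OF assms] convergent_imp_Bseq convergentI by blast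
  then obtain A where A: "\<And>n. norm (q_fact p n) \<le> A"
    by (auto simp: Bseq_def)
  have "Bseq (\<lambda>n. inverse (q_fact p n))"
    using Bfun_inverse[OF q_fact_LIMSEQ[OF assms] q_poch_one_nonzero[OF assms]] by simp
  then obtain B where B: "\<And>n. norm (inverse (q_fact p n)) \<le> B"
    by (auto simp: Bseq_def)
  have AB: "0 \<le> A" "0 \<le> B" using A[of 0] B[of 0] norm_ge_zero order_trans by blast+
  have "norm (q_binom p m k) \<le> A * (B * B)" for m k
  proof (cases "k \<le> m")
    case True
    hence "norm (q_binom p m k) = norm (q_fact p m) *
        (norm (inverse (q_fact p k)) * norm (inverse (q_fact p (m - k))))"
      by (simp add: q_binom_def norm_mult norm_divide norm_inverse field_simps)
    also have "\<dots> \<le> A * (B * B)"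
      by (intro mult_mono A B) (use AB in auto)
    finally show ?thesis .
  qed (use AB in \<open>auto simp: q_binom_def\<close>)
  thus ?thesis using that by blast
qed

lemma q_binom_central_LIMSEQ:
  assumes "norm p < 1"
  shows "(\<lambda>N. q_binom p (2 * N) (nat (int N + m))) \<longlonglongrightarrow> 1 / q_poch p 1"
proof -
  note lim = filterlim_compose[OF q_fact_LIMSEQ[OF assms]]
  have "filterlim (\<lambda>N. nat (int N + m)) at_top sequentially" for m
    unfolding filterlim_at_top eventually_at_top_linorder
  proof (intro allI)
    fix Z show "\<exists>N. \<forall>n\<ge>N. Z \<le> nat (int n + m)"
      by (rule exI[of _ "Z + nat (- m)"]) auto
  qed
  note l = this
  have "filterlim (\<lambda>N. 2 * N) at_top (sequentially :: nat filter)"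
    by (rule filterlim_subseq) (auto simp: strict_mono_def)
  hence "(\<lambda>N. q_fact p (2 * N) / (q_fact p (nat (int N + m)) * q_fact p (nat (int N + (- m)))))
     \<longlonglongrightarrow> q_poch p 1 / (q_poch p 1 * q_poch p 1)"
    by (intro tendsto_intros lim l) (use q_poch_one_nonzero[OF assms] in auto)
  moreover have "eventually (\<lambda>N. q_binom p (2 * N) (nat (int N + m)) =
      q_fact p (2 * N) / (q_fact p (nat (int N + m)) * q_fact p (nat (int N + (- m))))) sequentially"
    using eventually_ge_at_top[of "nat \<bar>m\<bar>"]
  proof eventually_elim
    case (elim N)
    have "2 * N - nat (int N + m) = nat (int N + (- m))" "nat (int N + m) \<le> 2 * N"
      using elim by linarith+
    thus ?case by (simp add: q_binom_def)
  qed
  ultimately have "(\<lambda>N. q_binom p (2 * N) (nat (int N + m))) \<longlonglongrightarrow> q_poch p 1 / (q_poch p 1 * q_poch p 1)"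
    using tendsto_cong by fast
  thus ?thesis using q_poch_one_nonzero[OF assms] by simp
qed

text \<open>The finite identity passes to the limit by dominated convergence for series (Tannery),
  with the integers enumerated by \<open>int_decode\<close>. Each central Gaussian coefficient tends
  to \<open>1 / q_poch p 1\<close>, which explains the constant.\<close>

theorem jacobi_triple_product:
  assumes "norm p < 1" "p \<noteq> 0" "x \<noteq> 0"
  shows "(jacobi_term p x has_sum (q_poch p 1 * theta p x)) UNIV"
proof -
  obtain C where C: "\<And>m k. norm (q_binom p m k) \<le> C"
    using q_binom_bounded[OF assms(1)] by blast
  \<comment> \<open>The cutoff matters: for m < -N, \<open>nat\<close> truncates to 0, where the
    Gaussian coefficient is 1 and not 0.\<close>
  define a where "a i N = (if \<bar>int_decode i\<bar> \<le> int N
      then q_binom p (2 * N) (nat (int N + int_decode i)) * jacobi_term p x (int_decode i) else 0)" for i N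
  define b where "b i = 1 / q_poch p 1 * jacobi_term p x (int_decode i)" for i
  have summ: "summable (\<lambda>i. norm (jacobi_term p x (int_decode i)))"
  proof -
    have "(\<lambda>i. norm (jacobi_term p x (int_decode i))) summable_on UNIV"
      using abs_summable_jacobi_term[OF assms]
        summable_on_reindex_bij_betw[OF bij_int_decode, of "\<lambda>m. norm (jacobi_term p x m)"]
      by simp
    thus ?thesis by (subst (asm) summable_on_UNIV_nonneg_real_iff) auto
  qed
  have "(\<lambda>N. \<Sum>i. a i N) \<longlonglongrightarrow> suminf b"
  proof (rule tannerys_theorem[THEN conjunct2, THEN conjunct2])
    show "(\<lambda>N. a i N) \<longlonglongrightarrow> b i" for i
    proof -
      have "eventually (\<lambda>N. a i N = q_binom p (2 * N) (nat (int N + int_decode i)) * jacobi_term p x (int_decode i)) sequentially"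
        using eventually_ge_at_top[of "nat \<bar>int_decode i\<bar>"]
        by eventually_elim (auto simp: a_def)
      moreover have "(\<lambda>N. q_binom p (2 * N) (nat (int N + int_decode i)) * jacobi_term p x (int_decode i)) \<longlonglongrightarrow> b i"
        unfolding b_def by (intro tendsto_intros q_binom_central_LIMSEQ assms)
      ultimately show ?thesis using tendsto_cong by fast
    qed
    show "eventually (\<lambda>(i, N). norm (a i N) \<le> C * norm (jacobi_term p x (int_decode i))) (at_top \<times>\<^sub>F sequentially)"
    proof (intro always_eventually allI, clarify)
      fix i N
      have "0 \<le> C" using C norm_ge_zero order_trans by blast
      thus "norm (a i N) \<le> C * norm (jacobi_term p x (int_decode i))"
        by (auto simp: a_def norm_mult intro!: mult_right_mono C)
    qed
    show "summable (\<lambda>i. C * norm (jacobi_term p x (int_decode i)))"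
      using summ by (rule summable_mult)
  qed simp
  moreover have "(\<Sum>i. a i N) = (\<Prod>j<N. (1 - p ^ j * x) * (1 - p ^ (j + 1) / x))" for N
  proof -
    have "(\<Sum>i. a i N) = (\<Sum>i\<in>int_encode ` {- int N..int N}. a i N)"
    proof (rule suminf_finite)
      fix i assume "i \<notin> int_encode ` {- int N..int N}"
      hence "int_decode i \<notin> {- int N..int N}"
        using int_decode_inverse[of i] by (metis image_eqI)
      thus "a i N = 0" by (auto simp: a_def)
    qed simp
    also have "\<dots> = (\<Sum>m\<in>{- int N..int N}. a (int_encode m) N)"
      by (subst sum.reindex) (auto simp: inj_on_def int_encode_eq)
    also have "\<dots> = (\<Sum>m\<in>{- int N..int N}. q_binom p (2 * N) (nat (int N + m)) * jacobi_term p x m)"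
      by (intro sum.cong) (auto simp: a_def)
    finally show ?thesis using finite_jacobi_triple_product[OF assms] by simp
  qed
  moreover have "(\<lambda>N. \<Prod>j<N. (1 - p ^ j * x) * (1 - p ^ (j + 1) / x)) \<longlonglongrightarrow> theta p x"
  proof -
    have "convergent_prod (\<lambda>j. 1 - p ^ j * x)"
      using convergent_prod_q_poch[OF assms(1), of x]
      by (subst convergent_prod_iff_shift[of _ 1, symmetric]) simp
    from convergent_prod_mult[OF this convergent_prod_q_poch[OF assms(1), of "1 / x"]]
    show ?thesis
      unfolding theta_def by (intro has_prod_imp_tendsto' convergent_prod_has_prod) simp
  qed
  ultimately have "suminf b = theta p x"
    using LIMSEQ_unique by simp
  moreover have "suminf b = 1 / q_poch p 1 * (\<Sum>i. jacobi_term p x (int_decode i))"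
    unfolding b_def using summable_norm_cancel[OF summ] by (rule suminf_mult)
  moreover have "(\<Sum>i. jacobi_term p x (int_decode i)) = infsum (jacobi_term p x) UNIV"
  proof -
    have "((\<lambda>i. jacobi_term p x (int_decode i)) has_sum (\<Sum>i. jacobi_term p x (int_decode i))) UNIV"
      by (rule norm_summable_imp_has_sum[OF summ summable_sums[OF summable_norm_cancel[OF summ]]])
    thus ?thesis
      using infsum_reindex_bij_betw[OF bij_int_decode, of "jacobi_term p x"] infsumI by metis
  qed
  ultimately have "infsum (jacobi_term p x) UNIV = q_poch p 1 * theta p x"
    using q_poch_one_nonzero[OF assms(1)] by (simp add: field_simps)
  thus ?thesis
    using abs_summable_summable[OF abs_summable_jacobi_term[OF assms]] has_sum_infsum by metis
qed

section \<open>The theta function as a two-by-two determinant\<close>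

lemma infsum_product:
  fixes f :: "'a \<Rightarrow> complex" and g :: "'b \<Rightarrow> complex"
  assumes "(\<lambda>(x, y). f x * g y) summable_on (A \<times> B)"
  shows "infsum (\<lambda>(x, y). f x * g y) (A \<times> B) = infsum f A * infsum g B"
  using infsum_Sigma'_banach[OF assms] by (simp add: infsum_cmult_right' infsum_cmult_left')

text \<open>Multiplying the triple product series for xu and x/u gives terms in x^(m+n) u^(m-n).
  Once the parity of m + n is fixed, the quadratic exponent of p separates, so each parity class
  sums to a function of x times a function of u. The case p = 0 stands apart because the proof of
  the triple product identity divides by powers of p.\<close>

lemma skew_theta_wedge:
  assumes "norm p < 1"
  shows "\<exists>P Q. \<forall>x u. x \<noteq> 0 \<longrightarrow> u \<noteq> 0 \<longrightarrow> skew_theta p x u = P x * Q u - Q x * P u"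
proof (cases "p = 0")
  case True
  have "skew_theta 0 x u = (x + 1 / x) - (u + 1 / u)" if "x \<noteq> 0" "u \<noteq> 0" for x u
    using that by (simp add: skew_theta_def theta_conv_q_poch q_poch_def field_simps)
  thus ?thesis
    unfolding True by (intro exI[of _ "\<lambda>x. x + 1 / x"] exI[of _ "\<lambda>_. 1"]) simp
next
  case False
  \<comment> \<open>Summed over e, \<open>B\<close> and \<open>D\<close> are Jacobi's theta_3 and,
    up to a factor p^(1/4), theta_2 of nome p, with u = exp(iz).\<close>
  define B where "B u = (\<lambda>e. p powi (e * e) * u powi (2 * e))" for u
  define D where "D u = (\<lambda>e. p powi (e * (e + 1)) * u powi (2 * e + 1))" for u
  have main: "(q_poch p 1)\<^sup>2 * (theta p (x * u) * theta p (x / u)) =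
      x * (infsum (D x) UNIV * infsum (B u) UNIV - infsum (B x) UNIV * infsum (D u) UNIV)"
    if nz: "x \<noteq> 0" "u \<noteq> 0" for x u
  proof -
    define J where "J = (\<lambda>(m, n). jacobi_term p (x * u) m * jacobi_term p (x / u) n)"
    have nz': "x * u \<noteq> 0" "x / u \<noteq> 0" using nz by auto
    note jtp = jacobi_triple_product[OF assms False nz'(1)] jacobi_triple_product[OF assms False nz'(2)]
    \<comment> \<open>Absolute summability over all pairs justifies the rearrangement by
      parity.\<close>
    have "(\<lambda>z. norm (J z)) summable_on (UNIV \<times> UNIV)"
      unfolding J_def using abs_summable_jacobi_term[OF assms False nz'(1)]
        abs_summable_jacobi_term[OF assms False nz'(2)]
      by (intro Infinite_Sum.abs_summable_on_Sigma_iff[THEN iffD2])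
         (auto simp: norm_mult abs_mult infsum_cmult_right' intro!: summable_on_cmult_left summable_on_cmult_right)
    hence summ: "J summable_on UNIV" by (simp add: abs_summable_summable)
    hence "infsum J UNIV = infsum (jacobi_term p (x * u)) UNIV * infsum (jacobi_term p (x / u)) UNIV"
      unfolding J_def using infsum_product[of "jacobi_term p (x * u)" "jacobi_term p (x / u)" UNIV UNIV]
      by simp
    also have "\<dots> = (q_poch p 1)\<^sup>2 * (theta p (x * u) * theta p (x / u))"
      using jtp by (simp add: infsumI power2_eq_square)
    finally have lhs: "infsum J UNIV = (q_poch p 1)\<^sup>2 * (theta p (x * u) * theta p (x / u))" .

    define S0 S1 :: "(int \<times> int) set" where "S0 = {(m, n). even (m + n)}" and "S1 = {(m, n). odd (m + n)}"
    have summ': "J summable_on S0" "J summable_on S1"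
      by (rule summable_on_subset_banach[OF summ]; simp)+
    have "UNIV = S0 \<union> S1" "S0 \<inter> S1 = {}" by (auto simp: S0_def S1_def)
    hence split: "infsum J UNIV = infsum J S0 + infsum J S1"
      using infsum_Un_disjoint[OF summ'] by simp

    have pw: "(x * u) powi m * (x / u) powi n = x powi (m + n) * u powi (m - n)" for m n
      using nz by (simp add: power_int_mult_distrib power_int_divide_distrib power_int_add power_int_diff)
    have J: "J (m, n) = (-1) powi (m + n) * p powi (m * (m - 1) div 2 + n * (n - 1) div 2) *
        (x powi (m + n) * u powi (m - n))" for m n
      unfolding pw[symmetric] using False by (simp add: J_def jacobi_term_def power_int_add mult_ac)
    have J0: "J (i + e, i - e) = (p powi (i * (i - 1)) * x powi (2 * i)) * B u e" for i e
    proof -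
      have "even ((i + e) * (i + e - 1))" "even ((i - e) * (i - e - 1))" by auto
      then obtain a b where ab: "(i + e) * (i + e - 1) = 2 * a" "(i - e) * (i - e - 1) = 2 * b"
        by (elim dvdE)
      have "(i + e) * (i + e - 1) + (i - e) * (i - e - 1) = 2 * (i * (i - 1) + e * e)"
        by (simp add: algebra_simps)
      hence "(i + e) * (i + e - 1) div 2 + (i - e) * (i - e - 1) div 2 = i * (i - 1) + e * e"
        unfolding ab by simp
      moreover have "i + e + (i - e) = 2 * i" "i + e - (i - e) = 2 * e" by auto
      moreover have "(-1 :: complex) powi (2 * i) = 1"
        by (simp add: power_int_mult)
      ultimately show ?thesis
        unfolding J B_def using False by (simp only: simp_thms) (simp add: power_int_add)
    qed
    have J1: "J (i + e + 1, i - e) = - (p powi (i * i) * x powi (2 * i + 1)) * D u e" for i e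
    proof -
      have "even ((i + e + 1) * (i + e + 1 - 1))" "even ((i - e) * (i - e - 1))" by auto
      then obtain a b where ab: "(i + e + 1) * (i + e + 1 - 1) = 2 * a" "(i - e) * (i - e - 1) = 2 * b"
        by (elim dvdE)
      have "(i + e + 1) * (i + e + 1 - 1) + (i - e) * (i - e - 1) = 2 * (i * i + e * (e + 1))"
        by (simp add: algebra_simps)
      hence "(i + e + 1) * (i + e + 1 - 1) div 2 + (i - e) * (i - e - 1) div 2 = i * i + e * (e + 1)"
        unfolding ab by simp
      moreover have "i + e + 1 + (i - e) = 2 * i + 1" "i + e + 1 - (i - e) = 2 * e + 1" by auto
      moreover have "(-1 :: complex) powi (2 * i + 1) = - 1"
        by (subst power_int_add) (auto simp: power_int_mult)
      ultimately show ?thesis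
        unfolding J D_def using False by (simp only: simp_thms) (simp add: power_int_add)
    qed

    have bij0: "bij_betw (\<lambda>(i, e). (i + e, i - e)) (UNIV \<times> UNIV) S0"
    proof (rule bij_betw_imageI)
      show "inj_on (\<lambda>(i, e). (i + e, i - e)) (UNIV \<times> UNIV :: (int \<times> int) set)"
        by (auto simp: inj_on_def)
      have "(m, n) \<in> range (\<lambda>(i, e). (i + e, i - e))" if mn: "even (m + n)" for m n :: int
      proof -
        obtain k where "m + n = 2 * k" using mn by (elim evenE)
        hence "(m, n) = (\<lambda>(i, e). (i + e, i - e)) (k, m - k)" by auto
        thus ?thesis by (rule range_eqI)
      qed
      thus "(\<lambda>(i, e). (i + e, i - e)) ` (UNIV \<times> UNIV) = S0"
        by (auto simp: S0_def)
    qed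
    have J0': "(\<lambda>z. J (case z of (i, e) \<Rightarrow> (i + e, i - e))) =
        (\<lambda>(i, e). (p powi (i * (i - 1)) * x powi (2 * i)) * B u e)"
      by (auto simp: J0)
    have r0:
      "J summable_on S0 \<longleftrightarrow> (\<lambda>(i, e). (p powi (i * (i - 1)) * x powi (2 * i)) * B u e) summable_on UNIV \<times> UNIV"
      "infsum J S0 = infsum (\<lambda>(i, e). (p powi (i * (i - 1)) * x powi (2 * i)) * B u e) (UNIV \<times> UNIV)"
      using summable_on_reindex_bij_betw[OF bij0, of J] infsum_reindex_bij_betw[OF bij0, of J] by (simp_all only: J0')
    have bij1: "bij_betw (\<lambda>(i, e). (i + e + 1, i - e)) (UNIV \<times> UNIV) S1"
    proof (rule bij_betw_imageI)
      show "inj_on (\<lambda>(i, e). (i + e + 1, i - e)) (UNIV \<times> UNIV :: (int \<times> int) set)"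
        by (auto simp: inj_on_def)
      have "(m, n) \<in> range (\<lambda>(i, e). (i + e + 1, i - e))" if mn: "odd (m + n)" for m n :: int
      proof -
        obtain k where "m + n = 2 * k + 1" using mn by (elim oddE)
        hence "(m, n) = (\<lambda>(i, e). (i + e + 1, i - e)) (k, m - k - 1)" by auto
        thus ?thesis by (rule range_eqI)
      qed
      thus "(\<lambda>(i, e). (i + e + 1, i - e)) ` (UNIV \<times> UNIV) = S1"
        by (auto simp: S1_def)
    qed
    have J1': "(\<lambda>z. J (case z of (i, e) \<Rightarrow> (i + e + 1, i - e))) =
        (\<lambda>(i, e). - (p powi (i * i) * x powi (2 * i + 1)) * D u e)"
      by (auto simp: J1)
    have r1:
      "J summable_on S1 \<longleftrightarrow> (\<lambda>(i, e). - (p powi (i * i) * x powi (2 * i + 1)) * D u e) summable_on UNIV \<times> UNIV"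
      "infsum J S1 = infsum (\<lambda>(i, e). - (p powi (i * i) * x powi (2 * i + 1)) * D u e) (UNIV \<times> UNIV)"
      using summable_on_reindex_bij_betw[OF bij1, of J] infsum_reindex_bij_betw[OF bij1, of J] by (simp_all only: J1')
    have "infsum J S0 = infsum (\<lambda>i. p powi (i * (i - 1)) * x powi (2 * i)) UNIV * infsum (B u) UNIV"
      using summ'(1) unfolding r0 by (rule infsum_product)
    \<comment> \<open>The shift i = e + 1 turns the exponents i(i-1) and 2i into e(e+1) and (2e+1) +
      1, so both parity classes involve the same two series.\<close>
    also have "infsum (\<lambda>i. p powi (i * (i - 1)) * x powi (2 * i)) UNIV = infsum (\<lambda>e. x * D x e) UNIV"
    proof (rule infsum_reindex_bij_witness[of _ "\<lambda>e. e + 1" "\<lambda>i. i - 1"])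
      fix i :: int
      have "x powi (2 * i) = x * x powi (2 * i - 1)"
        using nz by (simp add: power_int_diff)
      moreover have "2 * (i - 1) + 1 = 2 * i - 1" by simp
      ultimately show "x * D x (i - 1) = p powi (i * (i - 1)) * x powi (2 * i)"
        by (simp only: D_def) (simp add: mult_ac)
    qed auto
    finally have "infsum J S0 = x * infsum (D x) UNIV * infsum (B u) UNIV"
      by (simp add: infsum_cmult_right')
    moreover have "infsum J S1 = infsum (\<lambda>i. - (p powi (i * i) * x powi (2 * i + 1))) UNIV * infsum (D u) UNIV"
      using summ'(2) unfolding r1 by (rule infsum_product)
    moreover have "infsum (\<lambda>i. - (p powi (i * i) * x powi (2 * i + 1))) UNIV = (- x) * infsum (B x) UNIV"
    proof -
      have "(\<lambda>i. - (p powi (i * i) * x powi (2 * i + 1))) = (\<lambda>e. (- x) * B x e)"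
        using nz by (simp add: B_def power_int_add fun_eq_iff)
      thus ?thesis by (simp only: infsum_cmult_right')
    qed
    ultimately show ?thesis
      unfolding lhs[symmetric] split by (simp add: algebra_simps)
  qed
  have *: "skew_theta p x u = infsum (D x) UNIV / (q_poch p 1)\<^sup>2 * infsum (B u) UNIV
        - infsum (B x) UNIV * (infsum (D u) UNIV / (q_poch p 1)\<^sup>2)" if "x \<noteq> 0" "u \<noteq> 0" for x u
  proof -
    have "skew_theta p x u = ((q_poch p 1)\<^sup>2 * (theta p (x * u) * theta p (x / u))) / (x * (q_poch p 1)\<^sup>2)"
      using that q_poch_one_nonzero[OF assms] by (simp add: skew_theta_def)
    also have "\<dots> = (infsum (D x) UNIV * infsum (B u) UNIV - infsum (B x) UNIV * infsum (D u) UNIV) / (q_poch p 1)\<^sup>2"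
      unfolding main[OF that] using that by simp
    finally show ?thesis by (simp add: diff_divide_distrib)
  qed
  show ?thesis
  proof (intro exI allI impI)
    fix x u :: complex assume "x \<noteq> 0" "u \<noteq> 0"
    thus "skew_theta p x u = infsum (D x) UNIV / (q_poch p 1)\<^sup>2 * infsum (B u) UNIV
        - infsum (B x) UNIV * (infsum (D u) UNIV / (q_poch p 1)\<^sup>2)" by (rule *)
  qed
qed

section \<open>Partial fractions\<close>

text \<open>As a function of a, every \<open>w a y\<close> lies in the span of P and Q. The
  numerator is thus a binary form in (P a, Q a) of degree two less than the number of points, and
  the sum is a vanishing Lagrange sum. Indexing the zeros by \<open>K\<close> allows them to
  coincide.\<close>

lemma partial_fractions:
  fixes P Q :: "'a \<Rightarrow> 'c :: field" and u :: "'b \<Rightarrow> 'a"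
  defines "w \<equiv> \<lambda>x y. P x * Q y - Q x * P y"
  assumes "finite K" "finite S" "card S = card K + 2"
    and "\<And>a b. a \<in> S \<Longrightarrow> b \<in> S \<Longrightarrow> a \<noteq> b \<Longrightarrow> w a b \<noteq> 0"
  shows "(\<Sum>a\<in>S. (\<Prod>k\<in>K. w a (u k)) / (\<Prod>b\<in>S - {a}. w a b)) = 0"
  using assms(2-)
proof (induction K arbitrary: S rule: finite_induct)
  case empty
  then obtain s t where st: "S = {s, t}" "s \<noteq> t"
    by (metis add_0 card_2_iff card.empty)
  have "{s, t} - {t} = {s}" "{s, t} - {s} = {t}" using st by auto
  moreover have "w s t \<noteq> 0" "w t s = - w s t"
    using empty.prems(3)[of s t] st by (auto simp: w_def)
  ultimately show ?case using st by simp
next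
  case (insert k K)
  have "card S \<noteq> 0" "card S \<noteq> 1" using insert.prems insert.hyps by auto
  then obtain s t where st: "s \<in> S" "t \<in> S" "s \<noteq> t"
    by (metis card_1_singleton_iff card_eq_0_iff ex_in_conv is_singletonI' is_singleton_altdef)
  define R where "R a = (\<Prod>k\<in>K. w a (u k))" for a
  \<comment> \<open>The factor \<open>w a s\<close> kills the term a = s and cancels the factor b =
    s in all others, so the sum reduces to one point and one zero fewer.\<close>
  have red: "(\<Sum>a\<in>S. w a s * R a / (\<Prod>b\<in>S - {a}. w a b)) = 0" if s: "s \<in> S" for s
  proof -
    have "(\<Sum>a\<in>S. w a s * R a / (\<Prod>b\<in>S - {a}. w a b)) =
          (\<Sum>a\<in>S - {s}. w a s * R a / (\<Prod>b\<in>S - {a}. w a b))"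
      using insert.prems(1) s by (subst sum.remove[of S s]) (auto simp: w_def)
    also have "\<dots> = (\<Sum>a\<in>S - {s}. R a / (\<Prod>b\<in>(S - {s}) - {a}. w a b))"
    proof (rule sum.cong[OF refl])
      fix a assume a: "a \<in> S - {s}"
      have "(\<Prod>b\<in>S - {a}. w a b) = w a s * (\<Prod>b\<in>(S - {a}) - {s}. w a b)"
        using insert.prems(1) a s by (intro prod.remove) auto
      moreover have "(S - {a}) - {s} = (S - {s}) - {a}" by auto
      moreover have "w a s \<noteq> 0" using insert.prems(3) a s by auto
      ultimately show "w a s * R a / (\<Prod>b\<in>S - {a}. w a b) = R a / (\<Prod>b\<in>(S - {s}) - {a}. w a b)"
        by simp
    qed
    also have "\<dots> = 0"
      unfolding R_def using insert.prems insert.hyps s by (intro insert.IH) auto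
    finally show ?thesis .
  qed
  \<comment> \<open>These are the coordinates of \<open>w a (u k)\<close> with respect to
    \<open>w a s\<close> and \<open>w a t\<close>, read off at a = t and a = s. The expansion is the
    three-term Pluecker relation.\<close>
  define \<alpha> \<beta> where "\<alpha> = w t (u k) / w t s" and "\<beta> = w s (u k) / w s t"
  have "w s t \<noteq> 0" using insert.prems(3) st by auto
  have "w a (u k) = \<alpha> * w a s + \<beta> * w a t" for a
  proof -
    have "w t s = - w s t" by (simp add: w_def)
    hence "\<alpha> * w a s + \<beta> * w a t = (w s (u k) * w a t - w t (u k) * w a s) / w s t"
      by (simp add: \<alpha>_def \<beta>_def diff_divide_distrib)
    also have "w s (u k) * w a t - w t (u k) * w a s = w a (u k) * w s t"
      by (simp add: w_def algebra_simps)
    finally show ?thesis using \<open>w s t \<noteq> 0\<close> by simp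
  qed
  hence "(\<Prod>k\<in>insert k K. w a (u k)) / D = \<alpha> * (w a s * R a / D) + \<beta> * (w a t * R a / D)" for a D
    using insert.hyps by (simp add: R_def add_divide_distrib algebra_simps)
  hence "(\<Sum>a\<in>S. (\<Prod>k\<in>insert k K. w a (u k)) / (\<Prod>b\<in>S - {a}. w a b)) =
     \<alpha> * (\<Sum>a\<in>S. w a s * R a / (\<Prod>b\<in>S - {a}. w a b)) + \<beta> * (\<Sum>a\<in>S. w a t * R a / (\<Prod>b\<in>S - {a}. w a b))"
    by (simp only: sum.distrib sum_distrib_left)
  also have "\<dots> = 0" using red st by simp
  finally show ?case .
qed

text \<open>Numerator and denominator factors behave well under x -> e/x. Rescaling by a square root
  s of e turns this into inversion of x/s, so that every pair of theta factors becomes a value of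
  \<open>skew_theta\<close>, the zero for k sitting at \<open>u k * e\<close>.\<close>

lemma theta_partial_fractions:
  fixes u :: "'b \<Rightarrow> complex"
  assumes p: "norm p < 1" and e: "e \<noteq> 0" and fin: "finite K" "finite S" and card: "card S = card K + 2"
    and nz: "0 \<notin> S" "\<And>k. k \<in> K \<Longrightarrow> u k \<noteq> 0"
    and den: "\<And>a b. a \<in> S \<Longrightarrow> b \<in> S \<Longrightarrow> a \<noteq> b \<Longrightarrow> theta p (a / b) \<noteq> 0 \<and> theta p (a * b / e) \<noteq> 0"
  shows "(\<Sum>x\<in>S. (\<Prod>k\<in>K. theta p (u k * x) * theta p (u k * (e / x))) /
            (x * (\<Prod>a\<in>S - {x}. theta p (a / x) * theta p (a * x / e)))) = 0"
proof -
  define s where "s = csqrt e"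
  have s: "s \<noteq> 0" "e = s * s" using e by (auto simp: s_def simp flip: power2_eq_square)
  obtain P Q where PQ: "\<And>x y. x \<noteq> 0 \<Longrightarrow> y \<noteq> 0 \<Longrightarrow> skew_theta p x y = P x * Q y - Q x * P y"
    using skew_theta_wedge[OF p] by blast
  define w where "w x y = P (x / s) * Q (y / s) - Q (x / s) * P (y / s)" for x y
  have w: "w x y = - skew_theta p (y / s) (x / s)" if "x \<noteq> 0" "y \<noteq> 0" for x y
    using that s by (simp add: w_def PQ)
  have w_den: "theta p (a / x) * theta p (a * x / e) = - (a / s) * w x a" if "x \<noteq> 0" "a \<noteq> 0" for x a
    using that s by (simp add: w skew_theta_def mult_ac)
  have w_num: "theta p (v * x) * theta p (v * (e / x)) = - (v * s) * w x (v * e)" if "x \<noteq> 0" "v \<noteq> 0" for x v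
    using that s by (simp add: w skew_theta_def mult_ac)
  \<comment> \<open>The extra x in the denominator completes the product of -(a/s) over the other
    points, so the factor no longer depends on x.\<close>
  define C where "C = (\<Prod>a\<in>S. - (a / s))"
  have C: "C \<noteq> 0" using nz s fin by (auto simp: C_def)
  have "(\<Sum>x\<in>S. (\<Prod>k\<in>K. theta p (u k * x) * theta p (u k * (e / x))) /
            (x * (\<Prod>a\<in>S - {x}. theta p (a / x) * theta p (a * x / e)))) =
        (\<Sum>x\<in>S. - (1 / s) * (\<Prod>k\<in>K. - (u k * s)) / C *
           ((\<Prod>k\<in>K. w x (u k * e)) / (\<Prod>a\<in>S - {x}. w x a)))"
  proof (rule sum.cong[OF refl])
    fix x assume x: "x \<in> S"
    hence x0: "x \<noteq> 0" using nz by auto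
    have "(\<Prod>k\<in>K. theta p (u k * x) * theta p (u k * (e / x))) = (\<Prod>k\<in>K. - (u k * s)) * (\<Prod>k\<in>K. w x (u k * e))"
      unfolding prod.distrib[symmetric] by (intro prod.cong refl w_num x0 nz)
    moreover have "(\<Prod>a\<in>S - {x}. theta p (a / x) * theta p (a * x / e)) =
        (\<Prod>a\<in>S - {x}. - (a / s)) * (\<Prod>a\<in>S - {x}. w x a)"
      unfolding prod.distrib[symmetric] using nz by (intro prod.cong refl w_den x0) auto
    moreover have "C = - (x / s) * (\<Prod>a\<in>S - {x}. - (a / s))"
      unfolding C_def using fin(2) x by (rule prod.remove)
    ultimately show "(\<Prod>k\<in>K. theta p (u k * x) * theta p (u k * (e / x))) /
            (x * (\<Prod>a\<in>S - {x}. theta p (a / x) * theta p (a * x / e))) =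
          - (1 / s) * (\<Prod>k\<in>K. - (u k * s)) / C * ((\<Prod>k\<in>K. w x (u k * e)) / (\<Prod>a\<in>S - {x}. w x a))"
      using s x0 by simp
  qed
  also have "\<dots> = - (1 / s) * (\<Prod>k\<in>K. - (u k * s)) / C *
      (\<Sum>x\<in>S. (\<Prod>k\<in>K. w x (u k * e)) / (\<Prod>a\<in>S - {x}. w x a))"
    by (rule sum_distrib_left[symmetric])
  also have "(\<Sum>x\<in>S. (\<Prod>k\<in>K. w x (u k * e)) / (\<Prod>a\<in>S - {x}. w x a)) = 0"
    unfolding w_def
  proof (rule partial_fractions[OF fin card])
    fix a b assume ab: "a \<in> S" "b \<in> S" "a \<noteq> b"
    hence "theta p (b / a) * theta p (b * a / e) \<noteq> 0" using den by auto
    moreover have "a \<noteq> 0" "b \<noteq> 0" using ab nz by blast+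
    ultimately have "w a b \<noteq> 0" using w_den[of a b] by auto
    thus "P (a / s) * Q (b / s) - Q (a / s) * P (b / s) \<noteq> 0" by (simp add: w_def)
  qed
  finally show ?thesis by simp
qed

section \<open>A multivariate partial fraction identity\<close>

text \<open>By \<open>skew_theta_wedge\<close> this is a homogeneous Vandermonde product in the
  pairs (P, Q). A general index set allows single indices to be split off.\<close>

definition skew_vandermonde :: "complex \<Rightarrow> nat set \<Rightarrow> (nat \<Rightarrow> complex) \<Rightarrow> complex" where
  "skew_vandermonde p R x = (\<Prod>(i, j)\<in>{(i, j). i \<in> R \<and> j \<in> R \<and> i < j}. skew_theta p (x j) (x i))"

lemma skew_vandermonde_cong:
  "(\<And>i. i \<in> R \<Longrightarrow> x i = y i) \<Longrightarrow> skew_vandermonde p R x = skew_vandermonde p R y"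
  unfolding skew_vandermonde_def by (intro prod.cong) auto

text \<open>A pair (i, j) with j above i carries \<open>x i\<close> as second argument; each such
  reversal costs a sign.\<close>

lemma skew_vandermonde_remove:
  assumes p: "norm p < 1" and R: "finite R" "i \<in> R" and nz: "\<And>j. j \<in> R \<Longrightarrow> x j \<noteq> 0"
  shows "skew_vandermonde p R x =
    (-1) ^ card {j \<in> R. i < j} * (\<Prod>k\<in>R - {i}. skew_theta p (x i) (x k)) * skew_vandermonde p (R - {i}) x"
proof -
  define f where "f = (\<lambda>(i, j). skew_theta p (x j) (x i))"
  define L U where "L = {j \<in> R. j < i}" and "U = {j \<in> R. i < j}"
  define Z where "Z = {(k, j). k \<in> R - {i} \<and> j \<in> R - {i} \<and> k < j}"
  have fin: "finite L" "finite U" "finite Z"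
    using R by (auto simp: L_def U_def Z_def intro: finite_subset[of _ "R \<times> R"])
  have "{(k, j). k \<in> R \<and> j \<in> R \<and> k < j} = (\<lambda>k. (k, i)) ` L \<union> (\<lambda>j. (i, j)) ` U \<union> Z"
    using R by (auto simp: L_def U_def Z_def)
  hence "skew_vandermonde p R x = prod f ((\<lambda>k. (k, i)) ` L \<union> (\<lambda>j. (i, j)) ` U \<union> Z)"
    by (simp add: skew_vandermonde_def f_def)
  also have "\<dots> = prod f ((\<lambda>k. (k, i)) ` L) * prod f ((\<lambda>j. (i, j)) ` U) * prod f Z"
    using fin by (subst prod.union_disjoint; (subst prod.union_disjoint)?) (auto simp: L_def U_def Z_def)
  also have "prod f ((\<lambda>k. (k, i)) ` L) = (\<Prod>k\<in>L. skew_theta p (x i) (x k))"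
    by (subst prod.reindex) (auto simp: f_def inj_on_def)
  also have "prod f ((\<lambda>j. (i, j)) ` U) = (\<Prod>k\<in>U. - 1 * skew_theta p (x i) (x k))"
    by (subst prod.reindex)
       (auto simp: f_def inj_on_def U_def intro!: prod.cong skew_theta_commute[OF p] nz R)
  also have "\<dots> = (-1) ^ card U * (\<Prod>k\<in>U. skew_theta p (x i) (x k))"
    unfolding prod.distrib by simp
  also have "prod f Z = skew_vandermonde p (R - {i}) x"
    by (simp add: skew_vandermonde_def f_def Z_def)
  finally have "skew_vandermonde p R x = (-1) ^ card U *
      ((\<Prod>k\<in>L. skew_theta p (x i) (x k)) * (\<Prod>k\<in>U. skew_theta p (x i) (x k))) * skew_vandermonde p (R - {i}) x"
    by (simp add: mult_ac)
  also have "(\<Prod>k\<in>L. skew_theta p (x i) (x k)) * (\<Prod>k\<in>U. skew_theta p (x i) (x k)) =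
      (\<Prod>k\<in>L \<union> U. skew_theta p (x i) (x k))"
    using fin by (intro prod.union_disjoint[symmetric]) (auto simp: L_def U_def)
  also have "L \<union> U = R - {i}" by (auto simp: L_def U_def)
  finally show ?thesis by (simp add: U_def)
qed

text \<open>Splitting off i and then j leaves two products that trade places under the exchange, so
  only the factor joining \<open>x i\<close> and \<open>x j\<close> changes sign.\<close>

lemma skew_vandermonde_swap:
  assumes p: "norm p < 1" and R: "finite R" "i \<in> R" "j \<in> R" "i \<noteq> j" and nz: "\<And>k. k \<in> R \<Longrightarrow> x k \<noteq> 0"
  shows "skew_vandermonde p R (x(i := x j, j := x i)) = - skew_vandermonde p R x"
proof -
  define R' where "R' = R - {i} - {j}"
  define s :: complex where "s = (-1) ^ card {k \<in> R. i < k} * (-1) ^ card {k \<in> R - {i}. j < k}"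
  have expand: "skew_vandermonde p R z = s * skew_theta p (z i) (z j) *
      ((\<Prod>k\<in>R'. skew_theta p (z i) (z k)) * (\<Prod>k\<in>R'. skew_theta p (z j) (z k))) * skew_vandermonde p R' z"
    if z: "\<And>k. k \<in> R \<Longrightarrow> z k \<noteq> 0" for z
  proof -
    have "(\<Prod>k\<in>R - {i}. skew_theta p (z i) (z k)) =
        skew_theta p (z i) (z j) * (\<Prod>k\<in>R'. skew_theta p (z i) (z k))"
      unfolding R'_def using R by (intro prod.remove) auto
    moreover have "skew_vandermonde p (R - {i}) z = (-1) ^ card {k \<in> R - {i}. j < k} *
        (\<Prod>k\<in>R'. skew_theta p (z j) (z k)) * skew_vandermonde p R' z"
      unfolding R'_def using R z by (intro skew_vandermonde_remove p) auto
    ultimately show ?thesis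
      using skew_vandermonde_remove[OF p R(1,2) z] by (simp add: s_def mult_ac)
  qed
  define y where "y = x(i := x j, j := x i)"
  have y: "y i = x j" "y j = x i" "\<And>k. k \<in> R' \<Longrightarrow> y k = x k"
    using R by (auto simp: y_def R'_def)
  have "y k \<noteq> 0" if "k \<in> R" for k using that nz R by (auto simp: y_def)
  moreover have "skew_vandermonde p R' y = skew_vandermonde p R' x"
    by (rule skew_vandermonde_cong) (simp add: y)
  moreover have "skew_theta p (x j) (x i) = - skew_theta p (x i) (x j)"
    by (intro skew_theta_commute p nz R)
  ultimately have "skew_vandermonde p R y = - skew_vandermonde p R x"
    by (simp add: expand nz y mult_ac)
  thus ?thesis by (simp add: y_def)
qed

lemma prod_swap:
  fixes x :: "'i \<Rightarrow> 'a" and g :: "'a \<Rightarrow> 'c :: comm_monoid_mult"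
  assumes "i \<in> R" "j \<in> R" "i \<noteq> j"
  shows "(\<Prod>k\<in>R. g ((x(i := x j, j := x i)) k)) = (\<Prod>k\<in>R. g (x k))"
  by (rule prod.reindex_bij_witness[of _ "\<lambda>k. if k = i then j else if k = j then i else k"
        "\<lambda>k. if k = i then j else if k = j then i else k"]) (use assms in auto)

text \<open>In the application \<open>A i\<close> is the set of the values \<open>c\<^sub>i(t)\<close> with \<open>l\<^sub>i \<le> t \<le> n\<^sub>i\<close>, the set \<open>T\<close>
  consists of those with \<open>l\<^sub>i < t < n\<^sub>i\<close>, and \<open>J\<close> is the set of the indices with \<open>l\<^sub>i = n\<^sub>i\<close>.\<close>

locale theta_grid =
  fixes p b :: complex and R J :: "nat set" and A :: "nat \<Rightarrow> complex set" and S T Y :: "complex set"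
  defines "S \<equiv> (\<Union>i\<in>R. A i)" and "Y \<equiv> (\<Union>j\<in>J. A j)"
  assumes norm_p: "norm p < 1" and b_nz: "b \<noteq> 0"
    and finite_R: "finite R" and finite_A: "\<And>i. i \<in> R \<Longrightarrow> finite (A i)"
    and disjoint_A: "\<And>i j. i \<in> R \<Longrightarrow> j \<in> R \<Longrightarrow> i \<noteq> j \<Longrightarrow> A i \<inter> A j = {}"
    and J: "J \<subseteq> R" "\<And>j. j \<in> J \<Longrightarrow> \<exists>y. A j = {y}"
    and S_nz: "0 \<notin> S" and finite_T: "finite T" and T_nz: "0 \<notin> T"
    and card_T: "card T + 2 * card R = card S + card J"
    and theta_quotient_nz: "\<And>a c. a \<in> S \<Longrightarrow> c \<in> S \<Longrightarrow> a \<noteq> c \<Longrightarrow> theta p (a / c) \<noteq> 0"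
    and theta_product_nz: "\<And>a c. a \<in> Y \<Longrightarrow> c \<in> S \<Longrightarrow> theta p (a * c) \<noteq> 0"
    and theta_X_nz: "\<And>a x. a \<in> S \<Longrightarrow> x \<in> R \<rightarrow> S \<Longrightarrow> theta p (a * prod x R / b) \<noteq> 0"
    and theta_X_nz': "\<And>a x. a \<in> Y \<Longrightarrow> x \<in> R \<rightarrow> S \<Longrightarrow> theta p (a * b / prod x R) \<noteq> 0"
begin

text \<open>The denominator over \<open>Y\<close> is the correction for indices with
  \<open>l i = n i\<close>: there the numerator is empty, while the uniform formula contains a
  factor at \<open>x i\<close>.\<close>

definition weight :: "complex \<Rightarrow> complex" where
  "weight z = (\<Prod>a\<in>T. theta p (a * z)) / (\<Prod>a\<in>Y. theta p (a * z))"

text \<open>Each denominator is completed to the whole of \<open>S\<close>, which makes everything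
  except the Vandermonde product symmetric. When two entries of x in \<open>S\<close> coincide, that
  product vanishes while the denominators stay nonzero.\<close>

definition summand :: "(nat \<Rightarrow> complex) \<Rightarrow> complex" where
  "summand x =
     (\<Prod>i\<in>R. theta p (x i * prod x R / b) * theta p (x i * b / prod x R) / x i) *
     skew_vandermonde p R x * (weight (b / prod x R) * (\<Prod>i\<in>R. weight (x i))) /
     ((\<Prod>a\<in>S. theta p (a * prod x R / b)) * (\<Prod>i\<in>R. \<Prod>a\<in>S - {x i}. theta p (a / x i)))"

lemma finite_S: "finite S"
  using finite_R finite_A by (auto simp: S_def)

lemma summand_swap:
  assumes "i \<in> R" "j \<in> R" "i \<noteq> j" "x \<in> R \<rightarrow> S"
  shows "summand (x(i := x j, j := x i)) = - summand x"
proof -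
  have nz: "x k \<noteq> 0" if "k \<in> R" for k using that assms(4) S_nz by (metis Pi_mem)
  define y where "y = x(i := x j, j := x i)"
  note swap = prod_swap[OF assms(1-3), of _ x, folded y_def]
  have "prod y R = prod x R" using swap[of "\<lambda>z. z"] by simp
  moreover have "skew_vandermonde p R y = - skew_vandermonde p R x"
    unfolding y_def by (intro skew_vandermonde_swap norm_p finite_R assms nz)
  ultimately have "summand y = - summand x"
    unfolding summand_def using swap[of "\<lambda>z. theta p (z * prod x R / b) * theta p (z * b / prod x R) / z"]
      swap[of weight] swap[of "\<lambda>z. \<Prod>a\<in>S - {z}. theta p (a / z)"] by simp
  thus ?thesis by (simp add: y_def)
qed

text \<open>With the other variables fixed, the dependence on \<open>x i = a\<close> is that of a
  term of \<open>theta_partial_fractions\<close> with e equal to b over the product of the others.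
  In particular theta(x_i b/X) becomes the constant theta(e), where X is the product of all
  variables.\<close>

lemma sum_summand_single:
  assumes i: "i \<in> R - J" and x: "x \<in> R \<rightarrow> S" "\<And>j. j \<in> J \<Longrightarrow> x j \<in> A j"
  shows "(\<Sum>a\<in>S. summand (x(i := a))) = 0"
proof -
  define R' where "R' = R - {i}"
  define e where "e = b / prod x R'"
  have R': "finite R'" "J \<subseteq> R'" "i \<notin> R'" "R = insert i R'" using finite_R i J by (auto simp: R'_def)
  have xS: "x k \<in> S" if "k \<in> R'" for k using x(1) that by (auto simp: R'_def)
  have xnz: "x k \<noteq> 0" if "k \<in> R'" for k using xS[OF that] S_nz by auto
  have pnz: "prod x R' \<noteq> 0" using xnz R' by simp
  have e: "e \<noteq> 0" using pnz b_nz by (simp add: e_def)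
  \<comment> \<open>A grid with index in \<open>J\<close> is a single point, so these variables are
    frozen and their values make up \<open>Y\<close>.\<close>
  have Y: "Y = x ` J" "inj_on x J"
  proof -
    have "A j = {x j}" if "j \<in> J" for j using J(2)[OF that] x(2)[OF that] by auto
    thus "Y = x ` J" by (auto simp: Y_def)
    show "inj_on x J"
      using x(2) disjoint_A J(1) by (auto simp: inj_on_def) (metis IntI emptyE subsetD)
  qed
  define F where "F a u = theta p (u * a) * theta p (u * (e / a))" for a u
  \<comment> \<open>Zeros come from \<open>T\<close> and from 1/x_k and x_k for k other than i, but
    those at x_k with k in \<open>J\<close> cancel the denominator over \<open>Y\<close>. This
    leaves |T| + 2(|R| - 1) - |J| = |S| - 2 of them, which is the content of
    \<open>card_T\<close>.\<close>
  define K where "K = T <+> (R' <+> (R' - J))"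
  define u where "u = case_sum (\<lambda>t. t) (case_sum (\<lambda>k. 1 / x k) x)"
  define C where "C = theta p e * (-1) ^ card {k \<in> R. i < k} * skew_vandermonde p R' x *
     (\<Prod>k\<in>R'. weight (x k)) * (\<Prod>k\<in>R'. - (1 / e)) / (\<Prod>k\<in>R'. \<Prod>a\<in>S - {x k}. theta p (a / x k))"
  have upd: "x(i := a) \<in> R \<rightarrow> S" "prod (x(i := a)) R = a * prod x R'" if "a \<in> S" for a
  proof -
    show "x(i := a) \<in> R \<rightarrow> S" using x(1) that by auto
    have "prod (x(i := a)) R' = prod x R'" using R' by (intro prod.cong) auto
    thus "prod (x(i := a)) R = a * prod x R'" using R' by simp
  qed
  have ea_nz: "theta p (c * a / e) \<noteq> 0" if "a \<in> S" "c \<in> S" for a c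
    using theta_X_nz[OF that(2) upd(1)[OF that(1)]] upd(2)[OF that(1)] by (simp add: e_def mult_ac)
  have main: "summand (x(i := a)) = C * ((\<Prod>k\<in>K. F a (u k)) /
      (a * (\<Prod>c\<in>S - {a}. theta p (c / a) * theta p (c * a / e))))" if a: "a \<in> S" for a
  proof -
    define z where "z = x(i := a)"
    have z: "z i = a" "\<And>k. k \<in> R' \<Longrightarrow> z k = x k" "z \<in> R \<rightarrow> S" using R' upd[OF a] by (auto simp: z_def)
    have znz: "z k \<noteq> 0" if "k \<in> R" for k using that z(3) S_nz by (metis Pi_mem)
    have anz: "a \<noteq> 0" using a S_nz by auto
    have X: "prod z R = a * prod x R'" using upd(2)[OF a] by (simp add: z_def)
    have bX: "b / prod z R = e / a" "\<And>w. w * b / prod z R = w * (e / a)" "\<And>w. w * prod z R / b = w * a / e"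
      using pnz anz b_nz by (simp_all add: X e_def)
    have F_Y: "F a v \<noteq> 0" if "v \<in> Y" for v
      using theta_X_nz'[OF that z(3)] theta_product_nz[OF that a] by (simp add: F_def bX)
    have V: "skew_vandermonde p R z =
        (-1) ^ card {k \<in> R. i < k} * (\<Prod>k\<in>R'. skew_theta p a (x k)) * skew_vandermonde p R' x"
    proof -
      have "skew_vandermonde p (R - {i}) z = skew_vandermonde p R' x"
        unfolding R'_def[symmetric] by (rule skew_vandermonde_cong) (use z in auto)
      moreover have "(\<Prod>k\<in>R - {i}. skew_theta p (z i) (z k)) = (\<Prod>k\<in>R'. skew_theta p a (x k))"
        unfolding R'_def[symmetric] by (intro prod.cong) (use z in auto)
      ultimately show ?thesis
        using skew_vandermonde_remove[OF norm_p finite_R, of i z] i znz by simp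
    qed
    have split: "(\<Prod>k\<in>R. g (z k)) = g a * (\<Prod>k\<in>R'. g (x k))" for g :: "complex \<Rightarrow> complex"
      using R' z by (auto intro!: arg_cong2[of _ _ _ _ "(*)"] prod.cong)
    \<comment> \<open>Inverting the argument of theta(va/e) produces theta(e/(va)), and the
      monomials in v and a cancel, leaving a constant.\<close>
    have pair: "theta p (v * a / e) * theta p (v * (e / a)) / v * skew_theta p a v =
        - (1 / e) * (F a (1 / v) * F a v)" if "v \<noteq> 0" for v
    proof -
      have "theta p (e / (v * a)) = - theta p (v * a / e) / (v * a / e)"
        using theta_inverse[OF norm_p, of "v * a / e"] that anz e by simp
      hence "theta p (v * a / e) = - (v * a / e) * theta p (e / (v * a))"
        using that anz e by (simp add: field_simps)
      thus ?thesis using that anz e by (simp add: F_def skew_theta_def mult.commute[of a v])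
    qed
    have weights: "weight (e / a) * weight a = (\<Prod>v\<in>T. F a v) / (\<Prod>v\<in>Y. F a v)"
      by (simp add: weight_def F_def prod.distrib mult_ac)
    have F_split: "(\<Prod>k\<in>R'. F a (x k)) = (\<Prod>v\<in>Y. F a v) * (\<Prod>k\<in>R' - J. F a (x k))"
    proof -
      have "(\<Prod>k\<in>R'. F a (x k)) = (\<Prod>k\<in>J. F a (x k)) * (\<Prod>k\<in>R' - J. F a (x k))"
        using R' by (simp add: prod.subset_diff mult.commute)
      thus ?thesis by (simp add: Y prod.reindex)
    qed
    have FK: "(\<Prod>k\<in>K. F a (u k)) = (\<Prod>v\<in>T. F a v) * ((\<Prod>k\<in>R'. F a (1 / x k)) * (\<Prod>k\<in>R' - J. F a (x k)))"
      unfolding K_def u_def using finite_T R'(1) by (simp add: prod.Plus o_def)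
    have "finite Y" using R' by (simp add: Y finite_subset[of J])
    hence "(\<Prod>v\<in>Y. F a v) \<noteq> 0" using F_Y by simp
    hence FK': "(\<Prod>k\<in>K. F a (u k)) = weight (e / a) * weight a * (\<Prod>k\<in>R'. F a (1 / x k) * F a (x k))"
      unfolding FK weights prod.distrib F_split by simp
    have "(\<Prod>k\<in>R'. theta p (x k * a / e) * theta p (x k * (e / a)) / x k) * (\<Prod>k\<in>R'. skew_theta p a (x k)) =
        (\<Prod>k\<in>R'. - (1 / e) * (F a (1 / x k) * F a (x k)))"
      unfolding prod.distrib[symmetric] by (intro prod.cong refl) (use pair xnz in blast)
    also have "\<dots> = (\<Prod>k\<in>R'. - (1 / e)) * (\<Prod>k\<in>R'. F a (1 / x k) * F a (x k))"
      by (rule prod.distrib)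
    finally have pairs: "(\<Prod>k\<in>R'. theta p (x k * a / e) * theta p (x k * (e / a)) / x k) *
        (\<Prod>k\<in>R'. skew_theta p a (x k)) = \<dots>" .
    \<comment> \<open>The split-off factor theta(a^2/e) cancels theta(x_i X/b) in the
      numerator.\<close>
    have denS: "(\<Prod>c\<in>S. theta p (c * a / e)) = theta p (a * a / e) * (\<Prod>c\<in>S - {a}. theta p (c * a / e))"
      using finite_S a by (rule prod.remove)
    have "summand z = (theta p (a * a / e) * theta p e / a *
        (\<Prod>k\<in>R'. theta p (x k * a / e) * theta p (x k * (e / a)) / x k)) *
        ((-1) ^ card {k \<in> R. i < k} * (\<Prod>k\<in>R'. skew_theta p a (x k)) * skew_vandermonde p R' x) *
        (weight (e / a) * (weight a * (\<Prod>k\<in>R'. weight (x k)))) /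
        ((theta p (a * a / e) * (\<Prod>c\<in>S - {a}. theta p (c * a / e))) *
         ((\<Prod>c\<in>S - {a}. theta p (c / a)) * (\<Prod>k\<in>R'. \<Prod>c\<in>S - {x k}. theta p (c / x k))))"
      unfolding summand_def bX V split[of "\<lambda>v. theta p (v * a / e) * theta p (v * (e / a)) / v"]
        split[of weight] split[of "\<lambda>v. \<Prod>c\<in>S - {v}. theta p (c / v)"] denS using anz by simp
    also have "\<dots> = theta p e / a * (-1) ^ card {k \<in> R. i < k} * skew_vandermonde p R' x *
        (\<Prod>k\<in>R'. weight (x k)) * (weight (e / a) * weight a *
        ((\<Prod>k\<in>R'. theta p (x k * a / e) * theta p (x k * (e / a)) / x k) * (\<Prod>k\<in>R'. skew_theta p a (x k)))) /
        ((\<Prod>c\<in>S - {a}. theta p (c / a)) * (\<Prod>c\<in>S - {a}. theta p (c * a / e)) *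
         (\<Prod>k\<in>R'. \<Prod>c\<in>S - {x k}. theta p (c / x k)))"
      using ea_nz[OF a a] by simp (simp add: mult_ac)
    also have "\<dots> = C * ((\<Prod>k\<in>K. F a (u k)) /
      (a * (\<Prod>c\<in>S - {a}. theta p (c / a) * theta p (c * a / e))))"
      unfolding pairs FK' C_def prod.distrib by simp (simp add: mult_ac)
    finally show ?thesis by (simp add: z_def)
  qed
  have "(\<Sum>a\<in>S. summand (x(i := a))) = C * (\<Sum>a\<in>S. (\<Prod>k\<in>K. F a (u k)) /
      (a * (\<Prod>c\<in>S - {a}. theta p (c / a) * theta p (c * a / e))))"
    unfolding sum_distrib_left by (intro sum.cong refl main)
  also have "(\<Sum>a\<in>S. (\<Prod>k\<in>K. F a (u k)) / (a * (\<Prod>c\<in>S - {a}. theta p (c / a) * theta p (c * a / e)))) = 0"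
    unfolding F_def
  proof (rule theta_partial_fractions[OF norm_p e _ finite_S])
    show "finite K" using finite_T R' by (simp add: K_def)
    have "card J \<le> card R'" "card R = Suc (card R')" using R' by (auto intro: card_mono)
    thus "card S = card K + 2"
      using card_T finite_T R' by (simp add: K_def card_Plus card_Diff_subset finite_subset[OF R'(2) R'(1)])
  next
    fix k assume "k \<in> K"
    thus "u k \<noteq> 0" using xnz T_nz by (auto simp: K_def u_def)
  next
    fix a c assume "a \<in> S" "c \<in> S" "a \<noteq> c"
    thus "theta p (a / c) \<noteq> 0 \<and> theta p (a * c / e) \<noteq> 0"
      using theta_quotient_nz ea_nz by auto
  qed (rule S_nz)
  finally show ?thesis by (simp only: mult_zero_right)
qed

text \<open>Let \<open>x i\<close> range over all of \<open>S\<close>, where the sum is 0 by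
  \<open>sum_summand_single\<close>. The part with \<open>x i\<close> in a foreign grid
  \<open>A j\<close> vanishes: then \<open>x i\<close> and \<open>x j\<close> both range over
  \<open>A j\<close>, and exchanging them shows that this part equals its own negative.\<close>

theorem sum_summand:
  assumes "J \<noteq> R"
  shows "(\<Sum>x\<in>Pi\<^sub>E R A. summand x) = 0"
proof -
  obtain i where i: "i \<in> R - J" using assms J by auto
  define R' where "R' = R - {i}"
  have R': "finite R'" "i \<notin> R'" "R = insert i R'" using finite_R i by (auto simp: R'_def)
  define G where "G B = (\<Sum>a\<in>B. \<Sum>x\<in>Pi\<^sub>E R' A. summand (x(i := a)))" for B
  have "(\<Sum>x\<in>Pi\<^sub>E R A. summand x) = (\<Sum>z\<in>A i \<times> Pi\<^sub>E R' A. summand ((\<lambda>(a, x). x(i := a)) z))"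
    unfolding R'(3) PiE_insert_eq by (subst sum.reindex[OF inj_combinator[OF R'(2)]]) simp
  also have "\<dots> = G (A i)"
    by (simp add: G_def sum.cartesian_product case_prod_unfold)
  finally have "(\<Sum>x\<in>Pi\<^sub>E R A. summand x) = G (A i)" .
  have other: "G (A j) = 0" if j: "j \<in> R'" for j
  proof -
    \<comment> \<open>\<open>\<phi>\<close> exchanges the value a destined for i with the value at
      j.\<close>
    define \<phi> :: "complex \<times> (nat \<Rightarrow> complex) \<Rightarrow> complex \<times> (nat \<Rightarrow> complex)"
      where "\<phi> = (\<lambda>(a, x). (x j, x(j := a)))"
    have "G (A j) = (\<Sum>(a, x)\<in>A j \<times> Pi\<^sub>E R' A. summand (x(i := a)))"
      by (simp add: G_def sum.cartesian_product)
    also have "\<dots> = (\<Sum>(a, x)\<in>A j \<times> Pi\<^sub>E R' A. - summand (x(i := a)))"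
    proof (rule sum.reindex_bij_witness[of _ \<phi> \<phi>])
      fix z assume "z \<in> A j \<times> Pi\<^sub>E R' A"
      then obtain a x where z: "z = (a, x)" and ax: "a \<in> A j" "x \<in> Pi\<^sub>E R' A" by auto
      have "i \<noteq> j" using j R' by auto
      have "x(i := a) \<in> R \<rightarrow> S" using ax j R' by (auto simp: S_def PiE_def Pi_def)
      from summand_swap[OF _ _ \<open>i \<noteq> j\<close> this] have "summand ((x(j := a))(i := x j)) = - summand (x(i := a))"
        using i j R' \<open>i \<noteq> j\<close> by (simp add: fun_upd_twist)
      thus "(case \<phi> z of (a, x) \<Rightarrow> - summand (x(i := a))) = (case z of (a, x) \<Rightarrow> summand (x(i := a)))"
        by (simp add: z \<phi>_def)
    qed (use j in \<open>auto simp: \<phi>_def PiE_def extensional_def\<close>)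
    also have "\<dots> = - (\<Sum>(a, x)\<in>A j \<times> Pi\<^sub>E R' A. summand (x(i := a)))"
      by (simp add: case_prod_unfold sum_negf)
    also have "(\<Sum>(a, x)\<in>A j \<times> Pi\<^sub>E R' A. summand (x(i := a))) = G (A j)"
      by (simp add: G_def sum.cartesian_product)
    finally show ?thesis by simp
  qed
  have "G S = (\<Sum>x\<in>Pi\<^sub>E R' A. \<Sum>a\<in>S. summand (x(i := a)))"
    unfolding G_def by (rule sum.swap)
  also have "\<dots> = 0"
  proof (rule sum.neutral, rule ballI)
    fix x assume x: "x \<in> Pi\<^sub>E R' A"
    show "(\<Sum>a\<in>S. summand (x(i := a))) = 0"
    proof (cases "S = {}")
      case False
      then obtain c where c: "c \<in> S" by auto
      \<comment> \<open>As x is extensional on R', its value at i is undefined; overwriting it by a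
        point c of \<open>S\<close> meets the hypothesis and is itself overwritten by a.\<close>
      have "(\<Sum>a\<in>S. summand ((x(i := c))(i := a))) = 0"
        using i x J c R' by (intro sum_summand_single) (auto simp: S_def PiE_def Pi_def)
      thus ?thesis by simp
    qed simp
  qed
  also have "G S = (\<Sum>j\<in>R. G (A j))"
    unfolding G_def S_def using finite_R finite_A disjoint_A by (intro sum.UNION_disjoint) auto
  also have "\<dots> = G (A i) + (\<Sum>j\<in>R'. G (A j))" using R' by simp
  also have "(\<Sum>j\<in>R'. G (A j)) = 0" using other by simp
  finally show ?thesis using \<open>(\<Sum>x\<in>Pi\<^sub>E R A. summand x) = G (A i)\<close> by simp
qed

end


section \<open>From products of matrix entries to the antisymmetric summand\<close>

lemma prod_off_diagonal:
  fixes f :: "nat \<Rightarrow> nat \<Rightarrow> 'c :: comm_monoid_mult"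
  assumes "finite R"
  shows "(\<Prod>i\<in>R. \<Prod>j\<in>R - {i}. f i j) = (\<Prod>(i, j)\<in>{(i, j). i \<in> R \<and> j \<in> R \<and> i < j}. f i j * f j i)"
proof -
  define P where "P = {(i, j). i \<in> R \<and> j \<in> R \<and> i < j}"
  have fin: "finite P" using assms by (auto simp: P_def intro: finite_subset[of _ "R \<times> R"])
  have "(\<Prod>i\<in>R. \<Prod>j\<in>R - {i}. f i j) = (\<Prod>(i, j)\<in>(SIGMA i:R. R - {i}). f i j)"
    using assms by (subst prod.Sigma) auto
  also have "(SIGMA i:R. R - {i}) = P \<union> prod.swap ` P"
    by (auto simp: P_def image_iff)
  also have "(\<Prod>(i, j)\<in>P \<union> prod.swap ` P. f i j) = (\<Prod>(i, j)\<in>P. f i j) * (\<Prod>(i, j)\<in>prod.swap ` P. f i j)"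
    using fin by (intro prod.union_disjoint) (auto simp: P_def)
  also have "(\<Prod>(i, j)\<in>prod.swap ` P. f i j) = (\<Prod>(i, j)\<in>P. f j i)"
    by (subst prod.reindex) (auto simp: case_prod_unfold)
  finally show ?thesis by (simp add: P_def prod.distrib case_prod_unfold)
qed

lemma theta_pm_conv_skew_theta: "y \<noteq> 0 \<Longrightarrow> theta_pm p y x = y * skew_theta p y x"
  by (simp add: theta_pm_def skew_theta_def)

context theta_grid
begin

definition numer :: "(nat \<Rightarrow> complex) \<Rightarrow> complex \<Rightarrow> complex" where
  "numer x a = theta p (a * b / prod x R) * (\<Prod>j\<in>R. theta p (a * x j))"

definition denom :: "(nat \<Rightarrow> complex) \<Rightarrow> complex \<Rightarrow> complex" where
  "denom x a = theta p (a * prod x R / b) * (\<Prod>j\<in>R. theta p (a / x j))"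

text \<open>The denominators range over the grid points \<open>M\<close> that x does not select.
  Passing from \<open>M\<close> to \<open>S\<close> adds the factors \<open>B2\<close> and
  \<open>N2\<close>; together with the cross terms \<open>N1\<close> of the numerator,
  \<open>N2\<close> forms the square of the Vandermonde product up to sign and monomials, and one of
  the two copies cancels.\<close>

lemma summand_conv_quotient:
  assumes x: "x \<in> Pi\<^sub>E R A"
    and V_nz: "skew_vandermonde p R x \<noteq> 0" and sq_nz: "\<And>i. i \<in> R \<Longrightarrow> theta p ((x i)\<^sup>2) \<noteq> 0"
  shows "(\<Prod>i\<in>R. numer x (x i)) * ((\<Prod>a\<in>T. numer x a) / (\<Prod>a\<in>Y. numer x a)) /
           (\<Prod>i\<in>R. \<Prod>a\<in>A i - {x i}. denom x a) /
           (skew_vandermonde p R x * (\<Prod>i\<in>R. x i ^ card R * theta p ((x i)\<^sup>2))) =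
         (-1) ^ card {(i, j). i \<in> R \<and> j \<in> R \<and> i < j} * summand x"
proof -
  define V X where "V = skew_vandermonde p R x" and "X = prod x R"
  define P where "P = {(i, j). i \<in> R \<and> j \<in> R \<and> i < j}"
  define Q where "Q = (\<Prod>i\<in>R. theta p ((x i)\<^sup>2))"
  define W where "W = weight (b / X) * (\<Prod>i\<in>R. weight (x i))"
  define B1 B2 where "B1 = (\<Prod>i\<in>R. theta p (x i * b / X))" and "B2 = (\<Prod>i\<in>R. theta p (x i * X / b))"
  define N1 N2 where "N1 = (\<Prod>i\<in>R. \<Prod>j\<in>R - {i}. theta p (x i * x j))"
    and "N2 = (\<Prod>i\<in>R. \<Prod>j\<in>R - {i}. theta p (x i / x j))"
  define DD where "DD = (\<Prod>a\<in>S. theta p (a * X / b)) * (\<Prod>i\<in>R. \<Prod>a\<in>S - {x i}. theta p (a / x i))"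
  define M where "M = S - x ` R"
  have xA: "x i \<in> A i" if "i \<in> R" for i using x that by auto
  have xS: "x i \<in> S" if "i \<in> R" for i using xA[OF that] that by (auto simp: S_def)
  have xRS: "x \<in> R \<rightarrow> S" using xS by auto
  have xnz: "x i \<noteq> 0" if "i \<in> R" for i using xS[OF that] S_nz by auto
  have inj: "inj_on x R"
    using xA disjoint_A by (auto simp: inj_on_def) (metis IntI emptyE)
  have xi: "x i \<in> A j \<longleftrightarrow> i = j" if "i \<in> R" "j \<in> R" for i j
    using xA that disjoint_A[of i j] by blast
  have B2: "B2 \<noteq> 0" using theta_X_nz[OF xS xRS] finite_R by (simp add: B2_def X_def)
  have N2: "N2 \<noteq> 0"
  proof -
    have "theta p (x i / x j) \<noteq> 0" if "i \<in> R" "j \<in> R - {i}" for i j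
      using that inj by (intro theta_quotient_nz xS) (auto simp: inj_on_def)
    thus ?thesis using finite_R by (simp add: N2_def)
  qed

  have weights: "(\<Prod>a\<in>T. numer x a) / (\<Prod>a\<in>Y. numer x a) = W"
  proof -
    have "(\<Prod>a\<in>U. numer x a) = (\<Prod>a\<in>U. theta p (a * (b / X))) * (\<Prod>i\<in>R. \<Prod>a\<in>U. theta p (a * x i))" for U
      unfolding numer_def prod.distrib X_def by (subst (2) prod.swap) simp
    thus ?thesis by (simp add: W_def weight_def prod_dividef)
  qed

  have M_prod: "(\<Prod>a\<in>S - {x i}. g a) = (\<Prod>a\<in>M. g a) * (\<Prod>j\<in>R - {i}. g (x j))"
    if "i \<in> R" for g :: "complex \<Rightarrow> complex" and i
  proof -
    have "S - {x i} = M \<union> x ` (R - {i})" using xS inj that by (auto simp: M_def inj_on_def)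
    moreover have "prod g (M \<union> x ` (R - {i})) = prod g M * prod g (x ` (R - {i}))"
      using finite_S finite_R by (intro prod.union_disjoint) (auto simp: M_def)
    moreover have "prod g (x ` (R - {i})) = (\<Prod>j\<in>R - {i}. g (x j))"
      using inj by (subst prod.reindex) (auto intro: inj_on_subset)
    ultimately show ?thesis by simp
  qed
  have M_prod': "(\<Prod>a\<in>S. g a) = (\<Prod>a\<in>M. g a) * (\<Prod>j\<in>R. g (x j))" for g :: "complex \<Rightarrow> complex"
  proof -
    have "S = M \<union> x ` R" using xS by (auto simp: M_def)
    hence "prod g S = prod g (M \<union> x ` R)" by simp
    also have "\<dots> = prod g M * prod g (x ` R)"
      using finite_S finite_R by (intro prod.union_disjoint) (auto simp: M_def)
    also have "prod g (x ` R) = (\<Prod>j\<in>R. g (x j))"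
      using inj by (subst prod.reindex) auto
    finally show ?thesis .
  qed
  have "(\<Prod>i\<in>R. \<Prod>a\<in>A i - {x i}. denom x a) = prod (denom x) (\<Union>i\<in>R. A i - {x i})"
    using finite_R finite_A disjoint_A by (intro prod.UNION_disjoint[symmetric]) auto
  also have "(\<Union>i\<in>R. A i - {x i}) = M"
    using xi by (auto simp: M_def S_def)
  also have "prod (denom x) M = (\<Prod>a\<in>M. theta p (a * X / b)) * (\<Prod>i\<in>R. \<Prod>a\<in>M. theta p (a / x i))"
    unfolding denom_def prod.distrib X_def by (subst (2) prod.swap) simp
  finally have dens: "(\<Prod>i\<in>R. \<Prod>a\<in>A i - {x i}. denom x a) = \<dots>" .
  have N2': "(\<Prod>i\<in>R. \<Prod>j\<in>R - {i}. theta p (x j / x i)) = N2"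
    unfolding N2_def prod_off_diagonal[OF finite_R] by (simp only: mult.commute)
  have "(\<Prod>i\<in>R. \<Prod>a\<in>S - {x i}. theta p (a / x i)) = (\<Prod>i\<in>R. \<Prod>a\<in>M. theta p (a / x i)) * N2"
    unfolding N2'[symmetric] prod.distrib[symmetric] by (intro prod.cong refl M_prod)
  hence DD: "DD = (\<Prod>i\<in>R. \<Prod>a\<in>A i - {x i}. denom x a) * (B2 * N2)"
    unfolding dens DD_def M_prod' B2_def by (simp only: mult_ac)

  have "(\<Prod>i\<in>R. numer x (x i)) = B1 * (\<Prod>i\<in>R. \<Prod>j\<in>R. theta p (x i * x j))"
    unfolding numer_def prod.distrib B1_def X_def ..
  also have "(\<Prod>i\<in>R. \<Prod>j\<in>R. theta p (x i * x j)) = Q * N1"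
    unfolding Q_def N1_def prod.distrib[symmetric] power2_eq_square
    by (intro prod.cong refl prod.remove[OF finite_R])
  finally have nums: "(\<Prod>i\<in>R. numer x (x i)) = B1 * (Q * N1)" .
  \<comment> \<open>Each ordered pair contributes one \<open>skew_theta\<close> and one power of
    \<open>x i\<close>; joining a pair to its reverse gives a square and a sign.\<close>
  have "N1 * N2 = (\<Prod>i\<in>R. \<Prod>j\<in>R - {i}. x i * skew_theta p (x i) (x j))"
    unfolding N1_def N2_def prod.distrib[symmetric]
    by (intro prod.cong refl) (simp add: skew_theta_def xnz)
  also have "\<dots> = (\<Prod>i\<in>R. x i ^ (card R - 1)) * (\<Prod>i\<in>R. \<Prod>j\<in>R - {i}. skew_theta p (x i) (x j))"
    unfolding prod.distrib using finite_R by simp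
  also have "(\<Prod>i\<in>R. \<Prod>j\<in>R - {i}. skew_theta p (x i) (x j)) =
      (\<Prod>(i, j)\<in>P. - 1 * (skew_theta p (x j) (x i) * skew_theta p (x j) (x i)))"
    unfolding prod_off_diagonal[OF finite_R] P_def[symmetric]
  proof (rule prod.cong[OF refl])
    fix z assume "z \<in> P"
    then obtain i j where z: "z = (i, j)" "i \<in> R" "j \<in> R" by (auto simp: P_def)
    have "skew_theta p (x i) (x j) = - skew_theta p (x j) (x i)"
      by (intro skew_theta_commute norm_p xnz z)
    thus "(case z of (i, j) \<Rightarrow> skew_theta p (x i) (x j) * skew_theta p (x j) (x i)) =
        (case z of (i, j) \<Rightarrow> - 1 * (skew_theta p (x j) (x i) * skew_theta p (x j) (x i)))"
      by (simp add: z(1))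
  qed
  also have "\<dots> = (-1) ^ card P * (V * V)"
    unfolding case_prod_unfold prod.distrib by (simp add: V_def skew_vandermonde_def P_def case_prod_unfold)
  finally have N12: "N1 * N2 = (\<Prod>i\<in>R. x i ^ (card R - 1)) * ((-1) ^ card P * (V * V))" .

  have sm: "summand x = B1 * B2 / X * V * W / DD"
    unfolding summand_def B1_def B2_def X_def[symmetric] V_def W_def DD_def
    by (simp add: prod.distrib prod_dividef X_def mult_ac)
  have pow: "(\<Prod>i\<in>R. x i ^ card R * theta p ((x i)\<^sup>2)) = X * (\<Prod>i\<in>R. x i ^ (card R - 1)) * Q"
  proof -
    have "x i ^ card R = x i * x i ^ (card R - 1)" if "i \<in> R" for i
      using that finite_R by (metis card_gt_0_iff empty_iff power_eq_if not_less_zero)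
    hence "(\<Prod>i\<in>R. x i ^ card R * theta p ((x i)\<^sup>2)) = (\<Prod>i\<in>R. x i * x i ^ (card R - 1) * theta p ((x i)\<^sup>2))"
      by simp
    thus ?thesis by (simp only: prod.distrib X_def Q_def)
  qed
  have nz: "V \<noteq> 0" "Q \<noteq> 0" "X \<noteq> 0" "(\<Prod>i\<in>R. x i ^ (card R - 1)) \<noteq> 0"
    using V_nz sq_nz xnz finite_R by (auto simp: V_def Q_def X_def)
  have "(\<Prod>i\<in>R. numer x (x i)) * W / (\<Prod>i\<in>R. \<Prod>a\<in>A i - {x i}. denom x a) = B1 * Q * (N1 * N2) * B2 * W / DD"
    unfolding nums DD using B2 N2 by simp
  also have "\<dots> / (V * (\<Prod>i\<in>R. x i ^ card R * theta p ((x i)\<^sup>2))) = (-1) ^ card P * summand x"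
    unfolding N12 sm pow using nz by simp (simp add: mult_ac)
  finally show ?thesis unfolding weights V_def P_def .
qed

end

text \<open>The two denominator ranges miss exactly k. For l < n the two numerator ranges cover the
  open interval and contain k once more, also when k is an endpoint; for l = n both are
  empty.\<close>

lemma quotient_products_interval:
  fixes \<nu> \<delta> :: "int \<Rightarrow> complex"
  assumes "l \<le> k" "k \<le> n"
  shows "(\<Prod>t\<in>{k..n - 1}. \<nu> t) / (\<Prod>t\<in>{k + 1..n}. \<delta> t) * ((\<Prod>t\<in>{l + 1..k}. \<nu> t) / (\<Prod>t\<in>{l..k - 1}. \<delta> t)) =
    (if l = n then 1 else \<nu> k * (\<Prod>t\<in>{l<..<n}. \<nu> t)) / (\<Prod>t\<in>{l..n} - {k}. \<delta> t)"
proof -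
  have "{l..n} - {k} = {k + 1..n} \<union> {l..k - 1}" using assms by auto
  moreover have "prod \<delta> ({k + 1..n} \<union> {l..k - 1}) = prod \<delta> {k + 1..n} * prod \<delta> {l..k - 1}"
    by (intro prod.union_disjoint) auto
  moreover have "prod \<nu> {k..n - 1} * prod \<nu> {l + 1..k} = (if l = n then 1 else \<nu> k * prod \<nu> {l<..<n})"
  proof (cases "k = n")
    case True
    have "{l + 1..n} = insert n {l<..<n}" if "l < n" using that by auto
    thus ?thesis using True assms by auto
  next
    case False
    hence "{k..n - 1} = insert k {k + 1..n - 1}" "{l<..<n} = {k + 1..n - 1} \<union> {l + 1..k}"
      using assms by auto
    moreover have "prod \<nu> ({k + 1..n - 1} \<union> {l + 1..k}) = prod \<nu> {k + 1..n - 1} * prod \<nu> {l + 1..k}"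
      by (intro prod.union_disjoint) auto
    ultimately show ?thesis using False assms by simp
  qed
  ultimately show ?thesis by simp
qed

text \<open>This accounts for the exponent r + 1 - j in g: turning \<open>theta_pm\<close> into
  \<open>skew_theta\<close> costs x_j^(j-1), and the total power x_j^r is symmetric.\<close>

lemma prod_pairs_snd:
  fixes x :: "nat \<Rightarrow> 'c :: comm_monoid_mult"
  shows "(\<Prod>(i, j)\<in>{(i, j). i \<in> {1..r} \<and> j \<in> {1..r} \<and> i < j}. x j) = (\<Prod>j\<in>{1..r}. x j ^ (j - 1))"
proof -
  have "(\<Prod>(i, j)\<in>{(i, j). i \<in> {1..r} \<and> j \<in> {1..r} \<and> i < j}. x j) = (\<Prod>(j, i)\<in>(SIGMA j:{1..r}. {1..<j}). x j)"
    by (rule prod.reindex_bij_witness[of _ prod.swap prod.swap]) auto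
  also have "\<dots> = (\<Prod>j\<in>{1..r}. \<Prod>i\<in>{1..<j}. x j)"
    by (subst prod.Sigma) auto
  finally show ?thesis by simp
qed

section \<open>The products of matrix entries\<close>

text \<open>Only conditions on the sequences are collected here, since b is going to vary.\<close>

locale generic_sequences =
  fixes r :: nat and p :: complex and c :: "nat \<Rightarrow> int \<Rightarrow> complex"
  assumes norm_p: "norm p < 1"
    and c_nz: "\<And>i t. i \<in> {1..r} \<Longrightarrow> c i t \<noteq> 0"
    and c_quotient_nz: "\<And>i j s t. i \<in> {1..r} \<Longrightarrow> j \<in> {1..r} \<Longrightarrow> (i, t) \<noteq> (j, s) \<Longrightarrow>
      theta p (c i t / c j s) \<noteq> 0"
    and c_product_nz: "\<And>i j s t. i \<in> {1..r} \<Longrightarrow> j \<in> {1..r} \<Longrightarrow> i \<noteq> j \<Longrightarrow> theta p (c i t * c j s) \<noteq> 0"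
    and c_square_nz: "\<And>i t. i \<in> {1..r} \<Longrightarrow> theta p ((c i t)\<^sup>2) \<noteq> 0"
begin

abbreviation R :: "nat set" where "R \<equiv> {1..r}"

definition grid :: "(nat \<Rightarrow> int) \<Rightarrow> (nat \<Rightarrow> int) \<Rightarrow> nat \<Rightarrow> complex set" where
  "grid l n i = c i ` {l i..n i}"

definition grid_interior :: "(nat \<Rightarrow> int) \<Rightarrow> (nat \<Rightarrow> int) \<Rightarrow> complex set" where
  "grid_interior l n = (\<Union>i\<in>R. c i ` {l i<..<n i})"

definition flat :: "(nat \<Rightarrow> int) \<Rightarrow> (nat \<Rightarrow> int) \<Rightarrow> nat set" where
  "flat l n = {i \<in> R. l i = n i}"

text \<open>Here every coordinate of x may take values in any of the grids, and a may be an entry of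
  x, as the release of one variable demands. Extensional x keep the number of conditions
  finite.\<close>

definition good :: "(nat \<Rightarrow> int) \<Rightarrow> (nat \<Rightarrow> int) \<Rightarrow> complex \<Rightarrow> bool" where
  "good l n b \<longleftrightarrow> b \<noteq> 0 \<and>
     (\<forall>x\<in>R \<rightarrow>\<^sub>E (\<Union>i\<in>R. grid l n i). \<forall>a\<in>(\<Union>i\<in>R. grid l n i).
        theta p (a * prod x R / b) \<noteq> 0 \<and> theta p (a * b / prod x R) \<noteq> 0)"

lemma c_eq_iff: "i \<in> R \<Longrightarrow> j \<in> R \<Longrightarrow> c i t = c j s \<longleftrightarrow> i = j \<and> t = s"
  using c_quotient_nz[of i j t s] c_nz[of i t] c_nz[of j s] norm_p by (cases "(i, t) = (j, s)") auto

lemma inj_c: "i \<in> R \<Longrightarrow> inj_on (c i) B"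
  using c_eq_iff by (auto simp: inj_on_def)

lemma theta_grid:
  assumes good: "good l n b" and le: "mi_le r l n"
  shows "theta_grid p b R (flat l n) (grid l n) (grid_interior l n)"
proof
  let ?S = "\<Union>i\<in>R. grid l n i"
  let ?Y = "\<Union>j\<in>flat l n. grid l n j"
  show "norm p < 1" by (rule norm_p)
  show "b \<noteq> 0" using good by (simp add: good_def)
  show "grid l n i \<inter> grid l n j = {}" if "i \<in> R" "j \<in> R" "i \<noteq> j" for i j
    using that c_eq_iff by (auto simp: grid_def)
  show "flat l n \<subseteq> R" by (auto simp: flat_def)
  show "\<exists>y. grid l n j = {y}" if "j \<in> flat l n" for j
    using that by (auto simp: grid_def flat_def)
  have c_nz': "0 \<noteq> c i t" if "i \<in> R" for i t using c_nz[OF that, of t] by simp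
  show "0 \<notin> ?S" using c_nz' by (auto simp: grid_def)
  show "0 \<notin> grid_interior l n" using c_nz' by (auto simp: grid_interior_def)
  \<comment> \<open>An open integer interval has two points fewer than the closed one, except that a
    one-point interval loses only one. The exceptions are counted by \<open>flat\<close>.\<close>
  show "card (grid_interior l n) + 2 * card R = card ?S + card (flat l n)"
  proof -
    have "card ?S = (\<Sum>i\<in>R. card (grid l n i))"
      using c_eq_iff by (intro card_UN_disjoint) (auto simp: grid_def)
    also have "\<dots> = (\<Sum>i\<in>R. card {l i..n i})"
      unfolding grid_def by (intro sum.cong refl card_image inj_c)
    finally have S: "card ?S = (\<Sum>i\<in>R. card {l i..n i})" .
    have "card (grid_interior l n) = (\<Sum>i\<in>R. card (c i ` {l i<..<n i}))"
      unfolding grid_interior_def using c_eq_iff by (intro card_UN_disjoint) auto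
    also have "\<dots> = (\<Sum>i\<in>R. card {l i<..<n i})"
      by (intro sum.cong refl card_image inj_c)
    finally have "card (grid_interior l n) + 2 * card R = (\<Sum>i\<in>R. card {l i<..<n i} + 2)"
      unfolding sum.distrib by simp
    also have "\<dots> = (\<Sum>i\<in>R. card {l i..n i} + (if l i = n i then 1 else 0))"
    proof (rule sum.cong[OF refl])
      fix i assume "i \<in> R"
      hence "l i \<le> n i" using le by (auto simp: mi_le_def)
      thus "card {l i<..<n i} + 2 = card {l i..n i} + (if l i = n i then 1 else 0)"
        unfolding card_greaterThanLessThan_int card_atLeastAtMost_int by auto
    qed
    also have "\<dots> = card ?S + card (flat l n)"
      unfolding sum.distrib S flat_def by (simp add: sum.If_cases Int_def)
    finally show ?thesis .
  qed
  show "theta p (a / d) \<noteq> 0" if ad: "a \<in> ?S" "d \<in> ?S" "a \<noteq> d" for a d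
  proof -
    obtain i t j s where "i \<in> R" "a = c i t" "j \<in> R" "d = c j s"
      using ad by (auto simp: grid_def)
    thus ?thesis using c_quotient_nz[of i j t s] ad(3) by auto
  qed
  show "theta p (a * d) \<noteq> 0" if ad: "a \<in> ?Y" "d \<in> ?S" for a d
  proof -
    obtain j where j: "j \<in> R" "l j = n j" "a = c j (l j)"
      using ad(1) by (auto simp: grid_def flat_def)
    obtain i t where i: "i \<in> R" "d = c i t" "t \<in> {l i..n i}"
      using ad(2) by (auto simp: grid_def)
    show ?thesis
    proof (cases "i = j")
      case True
      hence "a * d = (c j (l j))\<^sup>2" using i j by (simp add: power2_eq_square)
      thus ?thesis using c_square_nz j by simp
    qed (use i j c_product_nz in auto)
  qed
  have prod_restrict: "restrict x R \<in> R \<rightarrow>\<^sub>E ?S" "prod (restrict x R) R = prod x R" if "x \<in> R \<rightarrow> ?S" for x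
    using that by auto
  show "theta p (a * prod x R / b) \<noteq> 0" if "a \<in> ?S" "x \<in> R \<rightarrow> ?S" for a x
    using good that(1) prod_restrict[OF that(2)] unfolding good_def by metis
  show "theta p (a * b / prod x R) \<noteq> 0" if "a \<in> ?Y" "x \<in> R \<rightarrow> ?S" for a x
  proof -
    have "a \<in> ?S" using that(1) by (auto simp: flat_def)
    thus ?thesis using good prod_restrict[OF that(2)] unfolding good_def by metis
  qed
qed (auto simp: grid_def grid_interior_def)

text \<open>All factors beside the summand depend on l alone and leave the sum over k. The part of
  the prefactor of g depending on k turns into a Vandermonde product times a symmetric
  function.\<close>

lemma f_mat_g_mat:
  assumes good: "good l n b" and lk: "mi_le r l k" and kn: "mi_le r k n"
  shows "f_mat r p c b n k * g_mat r p c b k l =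
    (\<Prod>(i, j)\<in>{(i, j). i \<in> R \<and> j \<in> R \<and> i < j}. theta_pm p (c j (l j)) (c i (l i))) *
    (\<Prod>j\<in>R. c j (l j) ^ (r + 1 - j) * theta p ((c j (l j))\<^sup>2)) *
    (-1) ^ card {(i, j). i \<in> R \<and> j \<in> R \<and> i < j} *
    theta_grid.summand p b R (flat l n) (grid l n) (grid_interior l n) (\<lambda>i\<in>R. c i (k i))"
proof -
  have "mi_le r l n" using lk kn by (fastforce simp: mi_le_def)
  interpret theta_grid p b R "flat l n" "grid l n" "\<Union>i\<in>R. grid l n i" "grid_interior l n" "\<Union>j\<in>flat l n. grid l n j"
    by (rule theta_grid[OF good \<open>mi_le r l n\<close>])
  define x where "x = (\<lambda>i\<in>R. c i (k i))"
  define P where "P = {(i, j). i \<in> R \<and> j \<in> R \<and> i < j}"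
  have lkn: "l i \<le> k i" "k i \<le> n i" if "i \<in> R" for i using that lk kn by (auto simp: mi_le_def)
  have xi: "x i = c i (k i)" if "i \<in> R" for i using that by (simp add: x_def)
  have xnz: "x i \<noteq> 0" if "i \<in> R" for i using that by (simp add: xi c_nz)
  have xA: "x \<in> Pi\<^sub>E R (grid l n)" using lkn by (auto simp: x_def grid_def)
  have xS: "x \<in> R \<rightarrow> (\<Union>i\<in>R. grid l n i)" using xA by auto
  have X: "cprod r c k = prod x R" by (simp add: cprod_def xi)
  have num: "num_factor r p c b k i = (\<lambda>t. numer x (c i t))" for i
    unfolding num_factor_def numer_def by (simp add: X xi)
  have den: "den_factor r p c b k i = (\<lambda>t. denom x (c i t))" for i
    unfolding den_factor_def denom_def by (simp add: X xi)
  have P: "{(i, j). 1 \<le> i \<and> i < j \<and> j \<le> r} = P" by (auto simp: P_def)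
  have finP: "finite P" by (auto simp: P_def intro: finite_subset[of _ "R \<times> R"])

  have numer_nz: "numer x a \<noteq> 0" if "a \<in> (\<Union>j\<in>flat l n. grid l n j)" for a
    unfolding numer_def using theta_X_nz'[OF that xS] finite_R
      theta_product_nz[OF that funcset_mem[OF xS]] by simp
  \<comment> \<open>For a flat index, \<open>h i\<close> equals the extracted factor at
    \<open>x i\<close>, so the quotient is 1 and agrees with the empty product.\<close>
  define h where "h i = (\<Prod>a\<in>grid l n i. numer x a)" for i
  have factor: "(\<Prod>t\<in>{k i..n i - 1}. numer x (c i t)) / (\<Prod>t\<in>{k i + 1..n i}. denom x (c i t)) *
      ((\<Prod>t\<in>{l i + 1..k i}. numer x (c i t)) / (\<Prod>t\<in>{l i..k i - 1}. denom x (c i t))) =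
      numer x (x i) * ((\<Prod>a\<in>c i ` {l i<..<n i}. numer x a) / (if i \<in> flat l n then h i else 1)) /
      (\<Prod>a\<in>grid l n i - {x i}. denom x a)" if i: "i \<in> R" for i
  proof -
    have 1: "(\<Prod>a\<in>grid l n i - {x i}. denom x a) = (\<Prod>t\<in>{l i..n i} - {k i}. denom x (c i t))"
    proof -
      have "grid l n i - {x i} = c i ` ({l i..n i} - {k i})"
        using c_eq_iff i by (auto simp: grid_def xi)
      thus ?thesis using inj_c[OF i] by (simp add: prod.reindex)
    qed
    have 2: "(\<Prod>a\<in>c i ` {l i<..<n i}. numer x a) = (\<Prod>t\<in>{l i<..<n i}. numer x (c i t))"
      using inj_c[OF i] by (simp add: prod.reindex)
    have "numer x (x i) / h i = 1" if flat: "l i = n i"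
    proof -
      have "k i = n i" using lkn[OF i] flat by simp
      hence "h i = numer x (x i)" using flat i by (simp add: h_def grid_def xi)
      moreover have "x i \<in> (\<Union>j\<in>flat l n. grid l n j)"
        using flat i xA by (auto simp: flat_def)
      ultimately show ?thesis using numer_nz by simp
    qed
    thus ?thesis
      unfolding quotient_products_interval[OF lkn[OF i]] 1 2 using i by (auto simp: flat_def xi)
  qed
  have prods: "(\<Prod>i\<in>R. numer x (x i) * ((\<Prod>a\<in>c i ` {l i<..<n i}. numer x a) / (if i \<in> flat l n then h i else 1)) /
      (\<Prod>a\<in>grid l n i - {x i}. denom x a)) =
      (\<Prod>i\<in>R. numer x (x i)) *
      ((\<Prod>a\<in>grid_interior l n. numer x a) / (\<Prod>a\<in>(\<Union>j\<in>flat l n. grid l n j). numer x a)) /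
      (\<Prod>i\<in>R. \<Prod>a\<in>grid l n i - {x i}. denom x a)"
  proof -
    have "(\<Prod>i\<in>R. \<Prod>a\<in>c i ` {l i<..<n i}. numer x a) = (\<Prod>a\<in>grid_interior l n. numer x a)"
      unfolding grid_interior_def using c_eq_iff by (intro prod.UNION_disjoint[symmetric]) auto
    moreover have "(\<Prod>i\<in>R. if i \<in> flat l n then h i else 1) = (\<Prod>i\<in>flat l n. h i)"
      by (rule prod.mono_neutral_cong_right) (auto simp: flat_def)
    moreover have "(\<Prod>i\<in>flat l n. h i) = (\<Prod>a\<in>(\<Union>j\<in>flat l n. grid l n j). numer x a)"
      unfolding h_def using c_eq_iff
      by (intro prod.UNION_disjoint[symmetric]) (auto simp: flat_def grid_def)
    ultimately show ?thesis by (simp only: prod.distrib prod_dividef)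
  qed

  have skew_nz: "skew_theta p (x j) (x i) \<noteq> 0" if "i \<in> R" "j \<in> R" "i \<noteq> j" for i j
    using that c_quotient_nz[of j i "k j" "k i"] c_product_nz[of j i "k j" "k i"]
    by (simp add: skew_theta_def xi c_nz)
  have V_nz: "skew_vandermonde p R x \<noteq> 0"
    using finP skew_nz by (auto simp: skew_vandermonde_def P_def)
  have pref: "(\<Prod>(i, j)\<in>P. theta_pm p (c j (k j)) (c i (k i))) *
        (\<Prod>j\<in>R. c j (k j) ^ (r + 1 - j) * theta p ((c j (k j))\<^sup>2)) =
      skew_vandermonde p R x * (\<Prod>i\<in>R. x i ^ card R * theta p ((x i)\<^sup>2))"
  proof -
    have "(\<Prod>(i, j)\<in>P. theta_pm p (c j (k j)) (c i (k i))) = (\<Prod>(i, j)\<in>P. x j * skew_theta p (x j) (x i))"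
      by (intro prod.cong refl) (auto simp: P_def theta_pm_conv_skew_theta xi c_nz)
    also have "\<dots> = (\<Prod>(i, j)\<in>P. x j) * skew_vandermonde p R x"
      by (simp add: case_prod_unfold prod.distrib skew_vandermonde_def P_def)
    also have "(\<Prod>(i, j)\<in>P. x j) = (\<Prod>j\<in>R. x j ^ (j - 1))"
      unfolding P_def by (rule prod_pairs_snd)
    finally have "(\<Prod>(i, j)\<in>P. theta_pm p (c j (k j)) (c i (k i))) *
        (\<Prod>j\<in>R. c j (k j) ^ (r + 1 - j) * theta p ((c j (k j))\<^sup>2)) = skew_vandermonde p R x *
        ((\<Prod>j\<in>R. x j ^ (j - 1)) * (\<Prod>j\<in>R. c j (k j) ^ (r + 1 - j) * theta p ((c j (k j))\<^sup>2)))"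
      by (simp only: mult_ac)
    also have "(\<Prod>j\<in>R. x j ^ (j - 1)) * (\<Prod>j\<in>R. c j (k j) ^ (r + 1 - j) * theta p ((c j (k j))\<^sup>2)) =
        (\<Prod>j\<in>R. x j ^ (j - 1) * (c j (k j) ^ (r + 1 - j) * theta p ((c j (k j))\<^sup>2)))"
      by (rule prod.distrib[symmetric])
    also have "(\<Prod>j\<in>R. x j ^ (j - 1) * (c j (k j) ^ (r + 1 - j) * theta p ((c j (k j))\<^sup>2))) =
        (\<Prod>i\<in>R. x i ^ card R * theta p ((x i)\<^sup>2))"
    proof (rule prod.cong[OF refl])
      fix j assume "j \<in> R"
      hence "x j ^ card R = x j ^ (j - 1) * x j ^ (r + 1 - j)" by (simp flip: power_add)
      thus "x j ^ (j - 1) * (c j (k j) ^ (r + 1 - j) * theta p ((c j (k j))\<^sup>2)) = x j ^ card R * theta p ((x j)\<^sup>2)"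
        using \<open>j \<in> R\<close> by (simp add: xi)
    qed
    finally show ?thesis .
  qed

  have "f_mat r p c b n k * g_mat r p c b k l =
      ((\<Prod>(i, j)\<in>P. theta_pm p (c j (l j)) (c i (l i))) *
       (\<Prod>j\<in>R. c j (l j) ^ (r + 1 - j) * theta p ((c j (l j))\<^sup>2))) *
      ((\<Prod>i\<in>R. (\<Prod>t\<in>{k i..n i - 1}. numer x (c i t)) / (\<Prod>t\<in>{k i + 1..n i}. denom x (c i t)) *
        ((\<Prod>t\<in>{l i + 1..k i}. numer x (c i t)) / (\<Prod>t\<in>{l i..k i - 1}. denom x (c i t)))) /
      ((\<Prod>(i, j)\<in>P. theta_pm p (c j (k j)) (c i (k i))) *
        (\<Prod>j\<in>R. c j (k j) ^ (r + 1 - j) * theta p ((c j (k j))\<^sup>2))))"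
    unfolding f_mat_def g_mat_def P
    by (simp only: lk kn if_True num den prod.distrib prod_dividef case_prod_unfold
        times_divide_eq_left times_divide_eq_right divide_divide_eq_left divide_divide_eq_right mult_ac)
  also have "(\<Prod>i\<in>R. (\<Prod>t\<in>{k i..n i - 1}. numer x (c i t)) / (\<Prod>t\<in>{k i + 1..n i}. denom x (c i t)) *
        ((\<Prod>t\<in>{l i + 1..k i}. numer x (c i t)) / (\<Prod>t\<in>{l i..k i - 1}. denom x (c i t)))) =
      (\<Prod>i\<in>R. numer x (x i) * ((\<Prod>a\<in>c i ` {l i<..<n i}. numer x a) / (if i \<in> flat l n then h i else 1)) /
      (\<Prod>a\<in>grid l n i - {x i}. denom x a))"
    by (intro prod.cong refl factor)
  also note prods
  also have "(\<Prod>i\<in>R. numer x (x i)) *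
      ((\<Prod>a\<in>grid_interior l n. numer x a) / (\<Prod>a\<in>(\<Union>j\<in>flat l n. grid l n j). numer x a)) /
      (\<Prod>i\<in>R. \<Prod>a\<in>grid l n i - {x i}. denom x a) /
      ((\<Prod>(i, j)\<in>P. theta_pm p (c j (k j)) (c i (k i))) *
        (\<Prod>j\<in>R. c j (k j) ^ (r + 1 - j) * theta p ((c j (k j))\<^sup>2))) = (-1) ^ card P * summand x"
    unfolding pref unfolding P_def
    by (intro summand_conv_quotient xA V_nz) (simp add: xi c_square_nz)
  finally show ?thesis by (simp only: P_def x_def mult_ac)
qed

lemma sum_f_mat_g_mat_good:
  assumes good: "good l n b" and le: "mi_le r l n" and neq: "flat l n \<noteq> R"
  shows "(\<Sum>k\<in>{k \<in> multi_index r. mi_le r l k \<and> mi_le r k n}. f_mat r p c b n k * g_mat r p c b k l) = 0"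
proof -
  interpret theta_grid p b R "flat l n" "grid l n" "\<Union>i\<in>R. grid l n i" "grid_interior l n" "\<Union>j\<in>flat l n. grid l n j"
    by (rule theta_grid[OF good le])
  define B where "B = {k \<in> multi_index r. mi_le r l k \<and> mi_le r k n}"
  define \<phi> where "\<phi> k = (\<lambda>i\<in>R. c i (k i))" for k
  have inj: "inj_on \<phi> B"
  proof (rule inj_onI)
    fix k k' assume k: "k \<in> B" "k' \<in> B" "\<phi> k = \<phi> k'"
    have "k i = k' i" if "i \<in> R" for i
      using fun_cong[OF k(3), of i] that c_eq_iff[OF that that] by (simp add: \<phi>_def)
    thus "k = k'" using k by (intro PiE_ext[of k R "\<lambda>_. UNIV" k']) (auto simp: B_def multi_index_def)
  qed
  have img: "\<phi> ` B = Pi\<^sub>E R (grid l n)"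
  proof (intro equalityI subsetI)
    fix x assume "x \<in> \<phi> ` B"
    thus "x \<in> Pi\<^sub>E R (grid l n)"
      by (auto simp: \<phi>_def B_def mi_le_def grid_def)
  next
    fix x assume x: "x \<in> Pi\<^sub>E R (grid l n)"
    have "\<forall>i\<in>R. \<exists>t. t \<in> {l i..n i} \<and> x i = c i t" 
      using PiE_mem[OF x] by (auto simp: grid_def image_iff Bex_def)
    then obtain k where k: "\<And>i. i \<in> R \<Longrightarrow> k i \<in> {l i..n i} \<and> x i = c i (k i)" by metis
    have "restrict k R \<in> B" using k by (auto simp: B_def multi_index_def mi_le_def)
    moreover have "x = \<phi> (restrict k R)"
      using x k by (auto simp: \<phi>_def fun_eq_iff PiE_def extensional_def)
    ultimately show "x \<in> \<phi> ` B" by blast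
  qed
  obtain C where C: "\<And>k. k \<in> B \<Longrightarrow> f_mat r p c b n k * g_mat r p c b k l = C * summand (\<phi> k)"
    using f_mat_g_mat[OF good] unfolding \<phi>_def B_def by blast
  have "(\<Sum>k\<in>B. f_mat r p c b n k * g_mat r p c b k l) = C * (\<Sum>k\<in>B. summand (\<phi> k))"
    unfolding sum_distrib_left by (intro sum.cong refl C)
  also have "(\<Sum>k\<in>B. summand (\<phi> k)) = (\<Sum>x\<in>Pi\<^sub>E R (grid l n). summand x)"
    unfolding img[symmetric] by (simp add: sum.reindex[OF inj])
  also have "\<dots> = 0" by (rule sum_summand[OF neq])
  finally show ?thesis by (simp add: B_def)
qed

end

section \<open>Triangular matrices and continuity\<close>

lemma mi_le_trans: "mi_le r l m \<Longrightarrow> mi_le r m k \<Longrightarrow> mi_le r l k"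
  unfolding mi_le_def by (meson order_trans)

lemma mi_le_refl [simp]: "mi_le r k k"
  by (simp add: mi_le_def)

lemma mi_le_antisym: "k \<in> multi_index r \<Longrightarrow> n \<in> multi_index r \<Longrightarrow> mi_le r k n \<Longrightarrow> mi_le r n k \<Longrightarrow> k = n"
  unfolding mi_le_def multi_index_def by (intro PiE_ext[of k "{1..r}" "\<lambda>_. UNIV" n]) (auto intro: antisym)

lemma finite_mi_interval: "finite {k \<in> multi_index r. mi_le r l k \<and> mi_le r k n}"
  by (rule finite_subset[of _ "Pi\<^sub>E {1..r} (\<lambda>i. {l i..n i})"])
     (auto simp: multi_index_def mi_le_def intro!: finite_PiE)

text \<open>Bracket \<open>f g f\<close> in two ways. Since g is a right inverse, the result is
  \<open>f n l\<close>. By induction on the size of the interval from l to n, the other bracketing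
  retains only k = n and k = l, and the unit diagonal isolates the entry of \<open>g f\<close> at
  (n, l).\<close>

lemma mi_product_left_inverse:
  assumes diag: "\<And>k. k \<in> multi_index r \<Longrightarrow> f k k = 1"
    and right: "\<And>n l. n \<in> multi_index r \<Longrightarrow> l \<in> multi_index r \<Longrightarrow>
      mi_product r f g n l = (if n = l then 1 else 0)"
    and n: "n \<in> multi_index r" and l: "l \<in> multi_index r"
  shows "mi_product r g f n l = (if n = l then 1 else 0)"
proof -
  define I where "I l n = {k \<in> multi_index r. mi_le r l k \<and> mi_le r k n}" for l n
  have fin: "finite (I l n)" for l n unfolding I_def by (rule finite_mi_interval)
  have prod: "mi_product r f g n l = (\<Sum>k\<in>I l n. f n k * g k l)" for f g n l
    by (simp add: mi_product_def I_def)
  have sub1: "I l k = {m \<in> I l n. mi_le r m k}" if "k \<in> I l n" for k n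
    using that by (auto simp: I_def intro: mi_le_trans)
  have sub2: "I m n = {k \<in> I l n. mi_le r m k}" if "m \<in> I l n" for m n
    using that by (auto simp: I_def intro: mi_le_trans)
  show ?thesis
  proof (cases "mi_le r l n")
    case False
    hence "I l n = {}" "n \<noteq> l" using mi_le_trans by (auto simp: I_def)
    thus ?thesis by (simp add: prod)
  next
    case True
    show ?thesis using n True
    proof (induction "card (I l n)" arbitrary: n rule: less_induct)
      case less
      have nI: "n \<in> I l n" using less.prems by (simp add: I_def)
      have lI: "l \<in> I l n" using less.prems l by (simp add: I_def)
      have "(\<Sum>k\<in>I l n. f n k * mi_product r g f k l) = (\<Sum>k\<in>I l n. \<Sum>m\<in>{m \<in> I l n. mi_le r m k}. f n k * g k m * f m l)"
        by (intro sum.cong refl) (simp add: prod sub1 sum_distrib_left mult.assoc)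
      also have "\<dots> = (\<Sum>m\<in>I l n. \<Sum>k\<in>{k \<in> I l n. mi_le r m k}. f n k * g k m * f m l)"
        by (rule sum.swap_restrict[OF fin fin])
      also have "\<dots> = (\<Sum>m\<in>I l n. mi_product r f g n m * f m l)"
        by (intro sum.cong refl) (simp add: prod sub2 sum_distrib_right)
      also have "\<dots> = (\<Sum>m\<in>I l n. if m = n then f n l else 0)"
        using less.prems(1) by (intro sum.cong refl) (auto simp: right I_def)
      also have "\<dots> = f n l" using nI fin by simp
      finally have "(\<Sum>k\<in>I l n. f n k * mi_product r g f k l) = f n l" .
      moreover have "(\<Sum>k\<in>I l n. f n k * mi_product r g f k l) =
          f n n * mi_product r g f n l + (\<Sum>k\<in>I l n - {n}. f n k * mi_product r g f k l)"
        using fin nI by (rule sum.remove)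
      moreover have "(\<Sum>k\<in>I l n - {n}. f n k * mi_product r g f k l) =
          (\<Sum>k\<in>I l n - {n}. if k = l then f n l else 0)"
      proof (intro sum.cong refl)
        fix k assume k: "k \<in> I l n - {n}"
        have "n \<notin> I l k"
          using k mi_le_antisym[of k r n] less.prems(1) by (auto simp: I_def)
        moreover have "I l k \<subseteq> I l n" using k sub1 by blast
        ultimately have "card (I l k) < card (I l n)"
          using nI by (intro psubset_card_mono fin) auto
        hence "mi_product r g f k l = (if k = l then 1 else 0)"
          using k by (intro less.hyps) (auto simp: I_def)
        thus "f n k * mi_product r g f k l = (if k = l then f n l else 0)" by simp
      qed
      moreover have "(\<Sum>k\<in>I l n - {n}. if k = l then f n l else 0) = (if n = l then 0 else f n l)"
        using fin lI by auto
      ultimately show ?case using diag[OF less.prems(1)] by (auto split: if_splits)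
    qed
  qed
qed

lemma isCont_num_factor:
  assumes "norm p < 1" "\<And>j t. j \<in> {1..r} \<Longrightarrow> c j t \<noteq> 0" "b \<noteq> 0" "i \<in> {1..r}"
  shows "isCont (\<lambda>b. num_factor r p c b k i t) b"
proof -
  have "cprod r c k \<noteq> 0" using assms by (simp add: cprod_def)
  thus ?thesis
    unfolding num_factor_def using assms by (intro continuous_intros isCont_theta) auto
qed

lemma isCont_den_factor:
  assumes "norm p < 1" "\<And>j t. j \<in> {1..r} \<Longrightarrow> c j t \<noteq> 0" "b \<noteq> 0" "i \<in> {1..r}"
  shows "isCont (\<lambda>b. den_factor r p c b k i t) b"
proof -
  have "cprod r c k \<noteq> 0" using assms by (simp add: cprod_def)
  thus ?thesis
    unfolding den_factor_def using assms by (intro continuous_intros isCont_theta) auto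
qed

text \<open>The denominators contain \<open>den_factor\<close> only at t different from
  \<open>k i\<close>, which is what \<open>generic\<close> covers; genericity at the single point b
  suffices.\<close>

lemma
  assumes "norm p < 1" "\<And>j t. j \<in> {1..r} \<Longrightarrow> c j t \<noteq> 0" "b \<noteq> 0" "generic r p c b" "k \<in> multi_index r"
  shows isCont_f_mat: "isCont (\<lambda>b. f_mat r p c b n k) b"
    and isCont_g_mat: "isCont (\<lambda>b. g_mat r p c b k l) b"
proof -
  have den: "den_factor r p c b k i t \<noteq> 0" if "i \<in> {1..r}" "t \<noteq> k i" for i t
    using assms(4,5) that by (auto simp: generic_def)
  note cont = isCont_num_factor[OF assms(1-3)] isCont_den_factor[OF assms(1-3)]
  show "isCont (\<lambda>b. f_mat r p c b n k) b"
  proof (cases "mi_le r k n")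
    case True
    have "isCont (\<lambda>b. \<Prod>i\<in>{1..r}. (\<Prod>t\<in>{k i..n i - 1}. num_factor r p c b k i t)
                    / (\<Prod>t\<in>{k i + 1..n i}. den_factor r p c b k i t)) b"
      by (intro continuous_prod isCont_divide cont) (use den in auto)
    thus ?thesis using True by (simp add: f_mat_def)
  qed (simp add: f_mat_def)
  show "isCont (\<lambda>b. g_mat r p c b k l) b"
  proof (cases "mi_le r l k")
    case True
    have "isCont (\<lambda>b. C * (\<Prod>i\<in>{1..r}. (\<Prod>t\<in>{l i + 1..k i}. num_factor r p c b k i t)
                      / (\<Prod>t\<in>{l i..k i - 1}. den_factor r p c b k i t))) b" for C
      by (intro isCont_mult continuous_const continuous_prod isCont_divide cont) (use den in auto)
    thus ?thesis using True by (simp only: g_mat_def if_True)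
  qed (simp add: g_mat_def)
qed

section \<open>The matrix inversion\<close>

lemma generic_sequences_generic:
  assumes p: "norm p < 1" and c: "\<And>j t. j \<in> {1..r} \<Longrightarrow> c j t \<noteq> 0" and gen: "generic r p c b"
  shows "generic_sequences r p c"
proof
  fix i j :: nat and s t :: int
  assume ij: "i \<in> {1..r}" "j \<in> {1..r}"
  define k where "k = (\<lambda>m\<in>{1..r}. if m = j then s else if m = i then t else 0)"
  have k: "k \<in> multi_index r" by (simp add: k_def multi_index_def)
  show "theta p ((c i t)\<^sup>2) \<noteq> 0"
  proof -
    have "(\<lambda>m\<in>{1..r}. t) \<in> multi_index r" by (simp add: multi_index_def)
    thus ?thesis using gen ij by (fastforce simp: generic_def)
  qed
  show "theta p (c i t / c j s) \<noteq> 0" if ne: "(i, t) \<noteq> (j, s)"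
  proof -
    \<comment> \<open>The value t + 1 keeps \<open>k i\<close> away from t when i differs from j;
      for i = j the hypothesis gives s \<noteq> t. The wanted theta value is then one factor of
      \<open>den_factor\<close>.\<close>
    define k where "k = (\<lambda>m\<in>{1..r}. if m = j then s else t + 1)"
    have "k \<in> multi_index r" "t \<noteq> k i" "k j = s"
      using ij ne by (auto simp: k_def multi_index_def)
    hence "den_factor r p c b k i t \<noteq> 0" using gen ij by (auto simp: generic_def)
    thus ?thesis using ij \<open>k j = s\<close> by (auto simp: den_factor_def)
  qed
  show "theta p (c i t * c j s) \<noteq> 0" if ne: "i \<noteq> j"
  proof -
    have kk: "k i = t" "k j = s" using ij ne by (auto simp: k_def)
    have pm: "theta_pm p (c n (k n)) (c m (k m)) \<noteq> 0" if "1 \<le> m \<and> m < n \<and> n \<le> r" for m n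
      using gen k that by (auto simp: generic_def)
    show ?thesis
    proof (cases "i < j")
      case True
      thus ?thesis using pm[of i j] ij kk by (simp add: theta_pm_def mult.commute)
    next
      case False
      thus ?thesis using pm[of j i] ij kk ne by (simp add: theta_pm_def)
    qed
  qed
qed (fact p, fact c)

section \<open>Exceptional values of the parameter b\<close>

context generic_sequences
begin

text \<open>For each of finitely many pairs (x, a), with X the product of x, a failure places b at
  aX/z or zX/a with z a zero of theta.\<close>

lemma countable_not_good: "countable {b. \<not> good l n b}"
proof -
  define S where "S = (\<Union>i\<in>R. grid l n i)"
  define Z where "Z = {z. theta p z = 0}"
  have Z: "countable Z" unfolding Z_def by (rule countable_theta_zeros[OF norm_p])
  have S: "finite S" "0 \<notin> S"
  proof -
    show "finite S" by (auto simp: S_def grid_def)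
    have "0 \<noteq> c i t" if "i \<in> R" for i t using c_nz[OF that, of t] by simp
    thus "0 \<notin> S" by (auto simp: S_def grid_def)
  qed
  have "{b. \<not> good l n b} \<subseteq> insert 0 (\<Union>x\<in>R \<rightarrow>\<^sub>E S. \<Union>a\<in>S.
      (\<lambda>z. a * prod x R / z) ` Z \<union> (\<lambda>z. z * prod x R / a) ` Z)" (is "_ \<subseteq> ?B")
  proof
    fix b assume "b \<in> {b. \<not> good l n b}"
    hence "b = 0 \<or> (\<exists>x\<in>R \<rightarrow>\<^sub>E S. \<exists>a\<in>S. a * prod x R / b \<in> Z \<or> a * b / prod x R \<in> Z)"
      by (auto simp: good_def S_def Z_def)
    thus "b \<in> ?B"
    proof (elim disjE bexE)
      fix x a assume xa: "x \<in> R \<rightarrow>\<^sub>E S" "a \<in> S"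
      have "\<And>i. i \<in> R \<Longrightarrow> x i \<noteq> 0" using PiE_mem[OF xa(1)] S by metis
      hence nz: "prod x R \<noteq> 0" "a \<noteq> 0" using xa S by auto
      {
        assume "a * prod x R / b \<in> Z"
        moreover have "b = a * prod x R / (a * prod x R / b)" using nz by simp
        ultimately show "b \<in> ?B" using xa by blast
      next
        assume "a * b / prod x R \<in> Z"
        moreover have "b = (a * b / prod x R) * prod x R / a" using nz by simp
        ultimately show "b \<in> ?B" using xa by blast
      }
    qed simp
  qed
  moreover have "countable ?B"
    using Z S(1) countable_finite[OF finite_PiE, of R "\<lambda>_. S"] countable_finite[OF S(1)]
    by (intro countable_insert countable_UN countable_Un countable_image) auto
  ultimately show ?thesis by (rule countable_subset)
qed

text \<open>The summation formula needs more nonvanishing theta factors than \<open>generic\<close> provides. They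
  can only fail for countably many values of \<open>b\<close>, so that the general case follows by continuity.\<close>

lemma mi_product_f_mat_g_mat:
  assumes b: "b \<noteq> 0" and gen: "generic r p c b" and n: "n \<in> multi_index r" and l: "l \<in> multi_index r"
  shows "mi_product r (f_mat r p c b) (g_mat r p c b) n l = (if n = l then 1 else 0)"
proof -
  define B where "B = {k \<in> multi_index r. mi_le r l k \<and> mi_le r k n}"
  define F where "F b = (\<Sum>k\<in>B. f_mat r p c b n k * g_mat r p c b k l)" for b
  have F: "mi_product r (f_mat r p c b) (g_mat r p c b) n l = F b"
    by (simp add: mi_product_def F_def B_def)
  consider "n = l" | "\<not> mi_le r l n" | "n \<noteq> l" "mi_le r l n" by blast
  thus ?thesis
  proof cases
    case 1
    have "B = {n}" using mi_le_antisym n by (auto simp: B_def 1)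
    moreover have "f_mat r p c b n n = 1" by (simp add: f_mat_def)
    moreover have "g_mat r p c b n n = 1"
    proof -
      have "theta_pm p (c j (n j)) (c i (n i)) \<noteq> 0" if "1 \<le> i" "i < j" "j \<le> r" for i j
        using gen n that by (auto simp: generic_def)
      hence "(\<Prod>(i, j)\<in>{(i, j). 1 \<le> i \<and> i < j \<and> j \<le> r}.
          theta_pm p (c j (n j)) (c i (n i)) / theta_pm p (c j (n j)) (c i (n i))) = 1"
        by (intro prod.neutral) auto
      moreover have "(\<Prod>j\<in>R. (c j (n j) ^ (r + 1 - j) * theta p ((c j (n j))\<^sup>2))
          / (c j (n j) ^ (r + 1 - j) * theta p ((c j (n j))\<^sup>2))) = 1"
        using c_nz c_square_nz by (intro prod.neutral) simp
      ultimately show ?thesis by (simp only: g_mat_def mi_le_refl if_True) simp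
    qed
    ultimately show ?thesis unfolding F by (simp add: F_def 1)
  next
    case 2
    hence "B = {}" "n \<noteq> l" using mi_le_trans by (auto simp: B_def)
    thus ?thesis unfolding F by (simp add: F_def)
  next
    case 3
    have "flat l n \<noteq> R"
    proof
      assume "flat l n = R"
      hence "\<forall>i\<in>R. i \<in> flat l n" by blast
      hence "mi_le r n l" by (simp add: flat_def mi_le_def)
      thus False using 3 mi_le_antisym n l by blast
    qed
    hence good: "F b' = 0" if "good l n b'" for b'
      using sum_f_mat_g_mat_good[OF that 3(2)] by (simp add: F_def B_def)
    have "isCont F b"
      unfolding F_def
      by (intro continuous_sum isCont_mult isCont_f_mat isCont_g_mat norm_p c_nz b gen) (auto simp: B_def)
    \<comment> \<open>Genericity is known only at b, which gives continuity there. A nonzero value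
      would persist on a ball, but a ball is uncountable and so contains good points.\<close>
    have "F b = 0"
    proof (rule ccontr)
      assume "F b \<noteq> 0"
      then obtain e where e: "e > 0" "\<And>b'. dist b b' < e \<Longrightarrow> F b' \<noteq> 0"
        using continuous_at_avoid[OF \<open>isCont F b\<close>] by blast
      have "ball b e \<subseteq> {b. \<not> good l n b}"
      proof
        fix b' assume "b' \<in> ball b e"
        hence "F b' \<noteq> 0" by (intro e(2)) simp
        thus "b' \<in> {b. \<not> good l n b}" using good[of b'] by blast
      qed
      hence "countable (ball b e)" using countable_not_good by (rule countable_subset)
      thus False using uncountable_ball[OF e(1), of b] by contradiction
    qed
    thus ?thesis unfolding F using 3 by simp
  qed
qed

end

theorem theorem3p5:
  fixes r :: nat and p b :: complex and c :: "nat \<Rightarrow> int \<Rightarrow> complex"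
  assumes "norm p < 1"
    and "r \<ge> 1"
    and "\<And>j t. j \<in> {1..r} \<Longrightarrow> c j t \<noteq> 0"
    and "b \<noteq> 0"
    and "generic r p c b"
  shows "mutually_inverse r (f_mat r p c b) (g_mat r p c b)"
proof -
  interpret generic_sequences r p c
    by (rule generic_sequences_generic) (fact assms)+
  have "f_mat r p c b k k = 1" for k by (simp add: f_mat_def)
  note right = mi_product_f_mat_g_mat[OF assms(4,5)]
  show ?thesis
    unfolding mutually_inverse_def lower_triangular_def
    using right mi_product_left_inverse[OF \<open>\<And>k. f_mat r p c b k k = 1\<close> right]
    by (simp add: f_mat_def g_mat_def)
qed

end
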